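(* Let $G$ be a connected graph of order $n$ containing at least two cycles, and suppose the circumference (length of a longest cycle) $\ell$ of $G$ satisfies $\ell\geq 6$. Then $trc(G)=2n-7$ if $\ell=6$ and $diam(G)=n-3$; otherwise $trc(G)\leq 2n-9$.
   Context: All graphs are finite, simple and undirected. A total-coloring assigns colors to all vertices and edges; a path is total-rainbow if its edges and internal vertices receive pairwise distinct colors; $trc(G)$ is the minimum number of colors in a total-coloring of the connected graph $G$ such that every two distinct vertices are joined by a total-rainbow path. $diam(G)$ is the diameter of $G$. *)

theory Defs
  imports Main
begin

definition simple_graph :: "'a set \<Rightarrow> 'a set set \<Rightarrow> bool" where
  "simple_graph V E \<longleftrightarrow> finite V \<and> (\<forall>e\<in>E. e \<subseteq> V \<and> card e = 2)"

definition is_path :: "'a set \<Rightarrow> 'a set set \<Rightarrow> 'a list \<Rightarrow> bool" where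
  "is_path V E p \<longleftrightarrow>
     p \<noteq> [] \<and> set p \<subseteq> V \<and> distinct p \<and> successively (\<lambda>u v. {u, v} \<in> E) p"

definition path_between :: "'a set \<Rightarrow> 'a set set \<Rightarrow> 'a \<Rightarrow> 'a list \<Rightarrow> 'a \<Rightarrow> bool" where
  "path_between V E u p v \<longleftrightarrow> is_path V E p \<and> hd p = u \<and> last p = v"

definition path_edges :: "'a list \<Rightarrow> 'a set list" where
  "path_edges p = map2 (\<lambda>u v. {u, v}) p (tl p)"

definition internal_vertices :: "'a list \<Rightarrow> 'a list" where
  "internal_vertices p = butlast (tl p)"

definition connected_graph :: "'a set \<Rightarrow> 'a set set \<Rightarrow> bool" where
  "connected_graph V E \<longleftrightarrow>
     V \<noteq> {} \<and> (\<forall>u\<in>V. \<forall>v\<in>V. \<exists>p. path_between V E u p v)"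

definition graph_dist :: "'a set \<Rightarrow> 'a set set \<Rightarrow> 'a \<Rightarrow> 'a \<Rightarrow> nat" where
  "graph_dist V E u v =
     (LEAST k. \<exists>p. path_between V E u p v \<and> length (path_edges p) = k)"

definition diam :: "'a set \<Rightarrow> 'a set set \<Rightarrow> nat" where
  "diam V E = Max {graph_dist V E u v | u v. u \<in> V \<and> v \<in> V}"

text \<open>Cycles are subgraphs, not vertex sequences: a cycle is identified with its edge set,
  so that rotations and reversals of the same vertex list are counted once.\<close>

definition cycles :: "'a set \<Rightarrow> 'a set set \<Rightarrow> 'a set set set" where
  "cycles V E =
     {insert {last p, hd p} (set (path_edges p)) | p.
        is_path V E p \<and> length p \<ge> 3 \<and> {last p, hd p} \<in> E}"

definition circumference :: "'a set \<Rightarrow> 'a set set \<Rightarrow> nat" where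
  "circumference V E = Max (card ` cycles V E)"

text \<open>A total-coloring is a function on the disjoint sum of vertices (\<open>Inl\<close>) and edges
  (\<open>Inr\<close>); only its values on the following set matter. It need not be proper.\<close>

definition elements :: "'a set \<Rightarrow> 'a set set \<Rightarrow> ('a + 'a set) set" where
  "elements V E = Inl ` V \<union> Inr ` E"

definition total_rainbow :: "('a + 'a set \<Rightarrow> nat) \<Rightarrow> 'a list \<Rightarrow> bool" where
  "total_rainbow c p \<longleftrightarrow>
     inj_on c (Inl ` set (internal_vertices p) \<union> Inr ` set (path_edges p))"

definition total_rainbow_connected ::
    "'a set \<Rightarrow> 'a set set \<Rightarrow> ('a + 'a set \<Rightarrow> nat) \<Rightarrow> bool" where
  "total_rainbow_connected V E c \<longleftrightarrow>
     (\<forall>u\<in>V. \<forall>v\<in>V. u \<noteq> v \<longrightarrow> (\<exists>p. path_between V E u p v \<and> total_rainbow c p))"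

definition trc :: "'a set \<Rightarrow> 'a set set \<Rightarrow> nat" where
  "trc V E =
     (LEAST k. \<exists>c. total_rainbow_connected V E c \<and> card (c ` elements V E) = k)"

end

theory Submission
  imports Defs
begin

text \<open>
  Attaching a new vertex to a colored connected subgraph costs at most two new colors, so the bound
  \<open>2 n - 9\<close> passes from a connected subgraph to the whole graph; call a graph good if it satisfies
  the bound. A longest cycle of length at least \<open>9\<close> is good, colored periodically; so are \<open>C\<^sub>8\<close>,
  \<open>C\<^sub>7\<close> with a pendant edge and \<open>C\<^sub>7\<close> with a chord. This settles circumference at least \<open>7\<close>.

  For circumference \<open>6\<close>, \<open>C\<^sub>6\<close> has a coloring with \<open>5\<close> colors, whence \<open>trc G \<le> 2 n - 7\<close>, while
  \<open>trc G \<ge> 2 diam G - 1\<close> always. Explicit colorings show that a graph that is not good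
  consists of a hexagon with chords and at most two path-like tails, attached at opposite vertices
  of the hexagon whose distance is still \<open>3\<close>: two pendant edges at non-opposite hexagon vertices, a
  branching tail, an ear, or a chord shortening the way between the tails all make it good. Such a
  graph has diameter \<open>n - 3\<close>.
\<close>

section \<open>Paths and their elements\<close>

text \<open>Growing a subgraph costs two colors per vertex, so the excess of twice the order over
  the number of colors survives; everything is about finding a subgraph where it is
  \<open>9\<close>. A cycle with as many colors as vertices has excess equal to its length, and the
  hexagon with five colors has excess \<open>7\<close>. At circumference \<open>6\<close> the value
  \<open>2 n - 8\<close> must not occur, so every deviation from the extremal shape has to save two
  colors at once. A branching may lie arbitrarily far out on a tail, beyond the reach of finitely
  many explicit colorings. For this reason two spare colors are reserved at a hexagon vertex and
  carried unchanged along the tail to the place where they are spent. No lower bound on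
  \<open>trc\<close> other than the one from the diameter is used. The same bound, read backwards,
  gives \<open>diam G \<le> n - 3\<close> as soon as \<open>2 n - 7\<close> colors suffice. The
  opposite inequality for graphs that are not good comes from an integer function on the vertices
  that changes by at most one along each edge.\<close>

lemma path_edges_simps [simp]:
  "path_edges [] = []" "path_edges [x] = []"
  "path_edges (x # y # r) = {x, y} # path_edges (y # r)"
  by (simp_all add: path_edges_def)

lemma path_edges_snoc:
  "p \<noteq> [] \<Longrightarrow> path_edges (p @ [w]) = path_edges p @ [{last p, w}]"
  by (induction p rule: induct_list012) auto

lemma length_path_edges [simp]: "length (path_edges p) = length p - 1"
  by (simp add: path_edges_def)

lemma path_edges_rev: "path_edges (rev p) = rev (path_edges p)"
proof (induction p rule: induct_list012)
  case (3 x y zs)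
  then show ?case using path_edges_snoc[of "rev zs @ [y]" x] by (simp add: insert_commute)
qed auto

lemma path_edges_subset: "e \<in> set (path_edges p) \<Longrightarrow> e \<subseteq> set p"
  by (induction p rule: induct_list012) auto

lemma successively_edges_iff:
  "successively (\<lambda>u v. {u, v} \<in> E) p \<longleftrightarrow> set (path_edges p) \<subseteq> E"
  by (induction p rule: induct_list012) auto

lemma distinct_path_edges: "distinct p \<Longrightarrow> distinct (path_edges p)"
proof (induction p rule: induct_list012)
  case (3 x y zs)
  have "{x, y} \<notin> set (path_edges (y # zs))"
    using 3(3) path_edges_subset[of "{x, y}" "y # zs"] by auto
  then show ?case using 3 by simp
qed auto

lemma set_internal_vertices: "distinct p \<Longrightarrow> set (internal_vertices p) = set p - {hd p, last p}"
proof (cases p rule: rev_cases)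
  case (snoc q y)
  then show "distinct p \<Longrightarrow> ?thesis"
    by (cases q) (auto simp: internal_vertices_def)
qed (simp add: internal_vertices_def)

lemma internal_vertices_rev: "internal_vertices (rev p) = rev (internal_vertices p)"
  by (metis internal_vertices_def butlast_rev butlast_tl rev_rev_ident)

lemma is_path_rev: "is_path V E p \<Longrightarrow> is_path V E (rev p)"
  by (auto simp: is_path_def successively_edges_iff path_edges_rev)

lemma path_between_rev: "path_between V E u p v \<Longrightarrow> path_between V E v (rev p) u"
  using is_path_rev[of V E p] by (auto simp: path_between_def hd_rev last_rev is_path_def)

lemma path_between_mono:
  "path_between V E u p v \<Longrightarrow> V \<subseteq> V' \<Longrightarrow> E \<subseteq> E' \<Longrightarrow> path_between V' E' u p v"
  by (auto simp: path_between_def is_path_def successively_edges_iff)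

lemma path_between_edge:
  "u \<in> V \<Longrightarrow> v \<in> V \<Longrightarrow> u \<noteq> v \<Longrightarrow> {u, v} \<in> E \<Longrightarrow> path_between V E u [u, v] v"
  by (auto simp: path_between_def is_path_def)

lemma path_between_snoc:
  "path_between V E u p v \<Longrightarrow> w \<in> V \<Longrightarrow> w \<notin> set p \<Longrightarrow> {v, w} \<in> E \<Longrightarrow> path_between V E u (p @ [w]) w"
  by (auto simp: path_between_def is_path_def successively_edges_iff path_edges_snoc)

lemma path_betweenD:
  assumes "path_between V E u p v"
  shows "p \<noteq> []" "distinct p" "set p \<subseteq> V" "set (path_edges p) \<subseteq> E" "hd p = u" "last p = v"
    "u \<in> set p" "v \<in> set p"
  using assms by (auto simp: path_between_def is_path_def successively_edges_iff)

lemma total_rainbow_rev: "total_rainbow c p \<Longrightarrow> total_rainbow c (rev p)"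
  by (simp add: total_rainbow_def path_edges_rev internal_vertices_rev)

lemma total_rainbow_edge [simp]: "total_rainbow c [u, v]"
  by (simp add: total_rainbow_def internal_vertices_def)

lemma total_rainbow_cong:
  assumes "total_rainbow c p"
    and "\<And>x. x \<in> Inl ` set (internal_vertices p) \<union> Inr ` set (path_edges p) \<Longrightarrow> c' x = c x"
  shows "total_rainbow c' p"
  using assms unfolding total_rainbow_def by (metis (no_types, lifting) inj_on_cong)

text \<open>The internal vertices number \<open>length p - 2\<close> and the edges
  \<open>length p - 1\<close>; the additive form avoids truncated subtraction.\<close>

lemma card_path_elements:
  assumes "path_between V E u p v" "u \<noteq> v"
  shows "card (Inl ` set (internal_vertices p) \<union> Inr ` set (path_edges p)) + 3 = 2 * length p"
proof -
  note p = path_betweenD[OF assms(1)]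
  have "card (set (internal_vertices p)) + 2 = length p"
  proof -
    have "card (set p - {u, v}) = card (set p) - card {u, v}"
      using p by (intro card_Diff_subset) auto
    moreover have "card {u, v} \<le> card (set p)" using p by (intro card_mono) auto
    ultimately show ?thesis
      using p assms(2) by (simp add: set_internal_vertices distinct_card)
  qed
  moreover have "card (set (path_edges p)) = length p - 1"
    using p by (simp add: distinct_card distinct_path_edges)
  moreover have "card (Inl ` set (internal_vertices p) \<union> Inr ` set (path_edges p))
      = card (set (internal_vertices p)) + card (set (path_edges p))"
    by (subst card_Un_disjoint) (auto simp: card_image)
  ultimately show ?thesis by simp
qed

section \<open>Colorability with a bounded number of colors\<close>

text \<open>Bounding the palette instead of counting colors makes the notion monotone in
  \<open>k\<close> and guarantees that \<open>k\<close> and \<open>k + 1\<close> are fresh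
  colors.\<close>

definition colorable :: "'a set \<Rightarrow> 'a set set \<Rightarrow> nat \<Rightarrow> bool" where
  "colorable V E k \<longleftrightarrow> (\<exists>c. total_rainbow_connected V E c \<and> c ` elements V E \<subseteq> {..<k})"

lemma trc_le: "colorable V E k \<Longrightarrow> trc V E \<le> k"
proof -
  assume "colorable V E k"
  then obtain c where c: "total_rainbow_connected V E c" "c ` elements V E \<subseteq> {..<k}"
    by (auto simp: colorable_def)
  have "trc V E \<le> card (c ` elements V E)"
    unfolding trc_def by (rule Least_le) (use c in auto)
  also have "\<dots> \<le> k" using card_mono[OF _ c(2)] by simp
  finally show ?thesis .
qed

lemma graph_dist_le:
  "path_between V E u p v \<Longrightarrow> graph_dist V E u v \<le> length p - 1"
  unfolding graph_dist_def by (rule Least_le) auto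

lemma finite_elements: "simple_graph V E \<Longrightarrow> finite (elements V E)"
  unfolding simple_graph_def elements_def
  by (metis Pow_iff finite_Pow_iff finite_UnI finite_imageI finite_subset subsetI)

lemma finite_distances: "finite V \<Longrightarrow> finite {graph_dist V E u v | u v. u \<in> V \<and> v \<in> V}"
  by (rule finite_image_set2) auto

lemma graph_dist_le_diam:
  "finite V \<Longrightarrow> u \<in> V \<Longrightarrow> v \<in> V \<Longrightarrow> graph_dist V E u v \<le> diam V E"
  unfolding diam_def by (rule Max_ge) (auto intro: finite_distances)

text \<open>A rainbow path between two vertices at distance \<open>diam V E\<close> has at least
  that many edges and one internal vertex fewer, all colored differently. Colorability ensures that
  the minimum defining \<open>trc\<close> is attained.\<close>

lemma diam_le_trc:
  assumes G: "simple_graph V E" "V \<noteq> {}" and col: "colorable V E k"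
  shows "2 * diam V E \<le> trc V E + 1"
proof -
  obtain c0 where "total_rainbow_connected V E c0" using col by (auto simp: colorable_def)
  then have "\<exists>c. total_rainbow_connected V E c \<and> card (c ` elements V E) = trc V E"
    unfolding trc_def
    by (intro LeastI[where k = "card (c0 ` elements V E)" and
          P = "\<lambda>k. \<exists>c. total_rainbow_connected V E c \<and> card (c ` elements V E) = k"]) blast
  then obtain c where c: "total_rainbow_connected V E c" "card (c ` elements V E) = trc V E"
    by auto
  have "diam V E \<in> {graph_dist V E u v | u v. u \<in> V \<and> v \<in> V}"
    unfolding diam_def using G by (intro Max_in finite_distances) (simp add: simple_graph_def, blast)
  then obtain u v where uv: "u \<in> V" "v \<in> V" "diam V E = graph_dist V E u v" by auto
  show ?thesis
  proof (cases "u = v")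
    case True
    have "graph_dist V E u v \<le> length [u] - 1"
      by (rule graph_dist_le) (use uv True in \<open>auto simp: path_between_def is_path_def\<close>)
    then show ?thesis using uv by simp
  next
    case False
    then obtain p where p: "path_between V E u p v" "total_rainbow c p"
      using c(1) uv by (auto simp: total_rainbow_connected_def)
    let ?X = "Inl ` set (internal_vertices p) \<union> Inr ` set (path_edges p)"
    have "?X \<subseteq> elements V E"
      using path_betweenD[OF p(1)] by (auto simp: elements_def set_internal_vertices)
    then have "card (c ` ?X) \<le> trc V E"
      using c(2) finite_elements[OF G(1)] by (metis card_mono finite_imageI image_mono)
    then have "card ?X \<le> trc V E"
      using p(2) by (simp add: total_rainbow_def card_image)
    then show ?thesis
      using card_path_elements[OF p(1) False] graph_dist_le[OF p(1)] uv(3) by linarith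
  qed
qed

section \<open>Growing a colored subgraph\<close>

lemma colorable_mono_edges:
  assumes "colorable V E k" "E \<subseteq> E'" "0 < k"
  shows "colorable V E' k"
proof -
  obtain c where c: "total_rainbow_connected V E c" "c ` elements V E \<subseteq> {..<k}"
    using assms by (auto simp: colorable_def)
  \<comment> \<open>The old rainbow paths are kept, so the new edges may take any color of the
    palette; \<open>0\<close> is one because \<open>0 < k\<close>.\<close>
  define c' where "c' = (\<lambda>x. if x \<in> elements V E then c x else 0)"
  have "\<exists>p. path_between V E' u p v \<and> total_rainbow c' p" if uv: "u \<in> V" "v \<in> V" "u \<noteq> v" for u v
  proof -
    obtain p where p: "path_between V E u p v" "total_rainbow c p"
      using c(1) uv by (auto simp: total_rainbow_connected_def)
    have "total_rainbow c' p"
      by (rule total_rainbow_cong[OF p(2)])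
         (use path_betweenD[OF p(1)] in \<open>auto simp: c'_def elements_def set_internal_vertices\<close>)
    then show ?thesis using path_between_mono[OF p(1) _ assms(2)] by auto
  qed
  moreover have "c' ` elements V E' \<subseteq> {..<k}" using c(2) assms(3) by (auto simp: c'_def)
  ultimately show ?thesis unfolding colorable_def total_rainbow_connected_def by blast
qed

text \<open>Appending \<open>w\<close> turns \<open>last p\<close> into an internal vertex while
  \<open>hd p\<close> stays an end, which is why the vertices of \<open>tl p\<close> are the ones
  that count.\<close>

lemma total_rainbow_snoc:
  assumes "p \<noteq> []" "inj_on c (Inl ` set (tl p) \<union> Inr ` set (path_edges p))"
    and "c (Inr {last p, w}) \<notin> c ` (Inl ` set (tl p) \<union> Inr ` set (path_edges p))"
  shows "total_rainbow c (p @ [w])"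
proof -
  have "Inl ` set (internal_vertices (p @ [w])) \<union> Inr ` set (path_edges (p @ [w]))
     = insert (Inr {last p, w}) (Inl ` set (tl p) \<union> Inr ` set (path_edges p))"
    using assms(1) by (auto simp: path_edges_snoc internal_vertices_def butlast_append)
  then show ?thesis using assms(2,3) unfolding total_rainbow_def by auto
qed

lemma set_tl_path:
  assumes "distinct p" "p \<noteq> []"
  shows "set (tl p) = set p - {hd p}"
  using assms by (cases p) auto

lemma total_rainbow_connectedI:
  assumes "\<And>x y. x \<in> A \<Longrightarrow> y \<in> A \<Longrightarrow> x \<noteq> y \<Longrightarrow> \<exists>p. path_between V E x p y \<and> total_rainbow c p"
    and "\<And>x. x \<in> A \<Longrightarrow> \<exists>p. path_between V E x p w \<and> total_rainbow c p"
    and "V = insert w A"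
  shows "total_rainbow_connected V E c"
proof -
  have "\<exists>p. path_between V E x p y \<and> total_rainbow c p"
    if xy: "x \<in> V" "y \<in> V" "x \<noteq> y" for x y
  proof (cases "x = w")
    case True
    then obtain p where "path_between V E y p x" "total_rainbow c p"
      using assms(2)[of y] assms(3) xy by auto
    then show ?thesis by (intro exI[of _ "rev p"] conjI path_between_rev total_rainbow_rev)
  next
    case False
    then show ?thesis using assms(1)[of x y] assms(2)[of x] assms(3) xy by (cases "y = w") auto
  qed
  then show ?thesis by (simp add: total_rainbow_connected_def)
qed

lemma colorable_add_pendant:
  assumes col: "colorable V E k" and u: "u \<in> V" and w: "w \<notin> V" and E: "\<Union>E \<subseteq> V"
  shows "colorable (insert w V) (insert {u, w} E) (k + 2)"
proof -
  obtain c where c: "total_rainbow_connected V E c" "c ` elements V E \<subseteq> {..<k}"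
    using col by (auto simp: colorable_def)
  \<comment> \<open>The vertex \<open>w\<close> is internal to none of the paths used, so its color
    is arbitrary.\<close>
  define c' where "c' = c(Inl u := k, Inr {u, w} := k + 1, Inl w := 0)"
  let ?V = "insert w V" and ?E = "insert {u, w} E"
  have wE: "{u, w} \<notin> E" using E w by auto
  have c'_in: "c' x = c x \<and> c x < k" if "x \<in> elements V E" "x \<noteq> Inl u" for x
    using that w wE c(2) by (auto simp: c'_def elements_def)
  have c'_u: "c' (Inl u) = k" "c' (Inr {u, w}) = k + 1" using u w by (auto simp: c'_def)
  have old: "\<exists>p. path_between ?V ?E x p y \<and> total_rainbow c' p"
    if xy: "x \<in> V" "y \<in> V" "x \<noteq> y" for x y
  proof -
    obtain p where p: "path_between V E x p y" "total_rainbow c p"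
      using c(1) xy by (auto simp: total_rainbow_connected_def)
    let ?X = "Inl ` set (internal_vertices p) \<union> Inr ` set (path_edges p)"
    have X: "?X \<subseteq> elements V E"
      using path_betweenD[OF p(1)] by (auto simp: elements_def set_internal_vertices)
    have "inj_on c' ?X"
    proof (rule inj_onI)
      fix a b assume ab: "a \<in> ?X" "b \<in> ?X" "c' a = c' b"
      then have "a \<in> elements V E" "b \<in> elements V E" using X by blast+
      then show "a = b"
        using c'_in[of a] c'_in[of b] c'_u ab p(2) unfolding total_rainbow_def
        by (metis inj_onD less_irrefl)
    qed
    then show ?thesis
      using path_between_mono[OF p(1), of ?V ?E] by (auto simp: total_rainbow_def)
  qed
  have new: "\<exists>p. path_between ?V ?E x p w \<and> total_rainbow c' p" if x: "x \<in> V" for x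
  proof (cases "x = u")
    case True
    moreover have "path_between ?V ?E u [u, w] w" by (rule path_between_edge) (use u w in auto)
    ultimately show ?thesis by (intro exI[of _ "[u, w]"]) simp
  next
    case False
    then obtain p where p: "path_between V E x p u" "total_rainbow c p"
      using c(1) x u by (auto simp: total_rainbow_connected_def)
    note pd = path_betweenD[OF p(1)]
    let ?X = "Inl ` set (internal_vertices p) \<union> Inr ` set (path_edges p)"
    have X: "?X \<subseteq> elements V E" "Inl u \<notin> ?X"
      using pd by (auto simp: elements_def set_internal_vertices)
    have in_X: "c' a = c a" "c a < k" if "a \<in> ?X" for a
      using c'_in[of a] X that by blast+
    have eq: "Inl ` set (tl p) \<union> Inr ` set (path_edges p) = insert (Inl u) ?X"
      using pd False by (auto simp: set_tl_path set_internal_vertices)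
    have "inj_on c' ?X"
      using p(2) in_X unfolding total_rainbow_def by (metis (no_types, lifting) inj_on_cong)
    moreover have "k \<notin> c' ` ?X" "k + 1 \<notin> c' ` ?X" using in_X by fastforce+
    ultimately have "total_rainbow c' (p @ [w])"
      using pd c'_u X(2) by (intro total_rainbow_snoc) (auto simp: eq)
    moreover have "path_between ?V ?E x (p @ [w]) w"
      by (rule path_between_snoc[of _ _ _ _ u])
         (use path_between_mono[OF p(1), of ?V ?E] pd w in auto)
    ultimately show ?thesis by blast
  qed
  have "total_rainbow_connected ?V ?E c'"
    by (rule total_rainbow_connectedI[OF old new refl])
  moreover have "c' x < k + 2" if x: "x \<in> elements ?V ?E" for x
  proof -
    consider "x = Inl w" | "x = Inl u" | "x = Inr {u, w}" | "x \<in> elements V E" "x \<noteq> Inl u"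
      using x by (auto simp: elements_def)
    then show ?thesis using c'_u c'_in[of x] by cases (auto simp: c'_def)
  qed
  ultimately show ?thesis unfolding colorable_def by blast
qed

lemma connected_boundary_edge:
  assumes G: "connected_graph V E" and A: "A \<subseteq> V" "A \<noteq> {}" "A \<noteq> V"
  obtains a b where "a \<in> A" "b \<in> V - A" "{a, b} \<in> E"
proof -
  obtain x y where xy: "x \<in> A" "y \<in> V - A" using A by auto
  then obtain p where p: "path_between V E x p y"
    using G A unfolding connected_graph_def by blast
  have "\<exists>a\<in>A. \<exists>b. b \<in> V - A \<and> {a, b} \<in> E"
    if "p \<noteq> []" "hd p \<in> A" "last p \<in> V - A" "set p \<subseteq> V" "set (path_edges p) \<subseteq> E" for p
    using that
  proof (induction p rule: induct_list012)
    case (3 a b r)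
    then show ?case by (cases "b \<in> A") auto
  qed auto
  from this[of p] show ?thesis using path_betweenD[OF p] xy that by blast
qed

text \<open>Vertices are attached one at a time along edges leaving the current set; once all are
  present, the remaining edges of \<open>E\<close> are free.\<close>

lemma colorable_supergraph:
  assumes G: "simple_graph V E" "connected_graph V E"
    and H: "colorable A F k" "A \<subseteq> V" "A \<noteq> {}" "F \<subseteq> E" "\<Union>F \<subseteq> A" "0 < k"
  shows "colorable V E (k + 2 * (card V - card A))"
  using H
proof (induction "card V - card A" arbitrary: A F k rule: less_induct)
  case less
  have fin: "finite V" using G by (auto simp: simple_graph_def)
  show ?case
  proof (cases "A = V")
    case True
    then show ?thesis using colorable_mono_edges[of V F k E] less.prems by simp
  next
    case False
    obtain a b where ab: "a \<in> A" "b \<in> V - A" "{a, b} \<in> E"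
      using connected_boundary_edge[OF G(2) less.prems(2,3) False] by blast
    have card: "card (insert b A) = card A + 1"
      using ab less.prems(2) fin by (auto simp: card_insert_if finite_subset)
    have "card (insert b A) \<le> card V"
      using ab less.prems(2) fin by (intro card_mono) auto
    note card = card this
    have "colorable V E ((k + 2) + 2 * (card V - card (insert b A)))"
    proof (rule less.hyps)
      show "colorable (insert b A) (insert {a, b} F) (k + 2)"
        using less.prems ab by (intro colorable_add_pendant) auto
    qed (use less.prems ab card in auto)
    moreover have "(k + 2) + 2 * (card V - card (insert b A)) = k + 2 * (card V - card A)"
      using card by simp
    ultimately show ?thesis by metis
  qed
qed

section \<open>Graphs with an explicit coloring\<close>

definition edge_color :: "((nat \<times> nat) \<times> nat) list \<Rightarrow> nat \<Rightarrow> nat \<Rightarrow> nat option" where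
  "edge_color es u v = map_of es (min u v, max u v)"

definition path_colors :: "nat list \<Rightarrow> ((nat \<times> nat) \<times> nat) list \<Rightarrow> nat list \<Rightarrow> nat list" where
  "path_colors cv es p =
     map ((!) cv) (internal_vertices p) @ map2 (\<lambda>u v. the (edge_color es u v)) p (tl p)"

text \<open>The list \<open>cv\<close> colors the vertices \<open>0, \<dots>, length cv - 1\<close>, \<open>es\<close> lists the edges (smaller end
  first) with their colors, and \<open>ps\<close> contains a rainbow path for every nonadjacent pair.\<close>

definition coloring_certificate ::
    "nat list \<Rightarrow> ((nat \<times> nat) \<times> nat) list \<Rightarrow> nat list list \<Rightarrow> nat \<Rightarrow> bool" where
  "coloring_certificate cv es ps k \<longleftrightarrow>
     (\<forall>x\<in>set cv. x < k) \<and>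
     (\<forall>((a, b), x)\<in>set es. a < b \<and> b < length cv \<and> x < k) \<and>
     (\<forall>p\<in>set ps. p \<noteq> [] \<and> distinct p \<and> (\<forall>v\<in>set p. v < length cv) \<and>
        successively (\<lambda>u v. edge_color es u v \<noteq> None) p \<and> distinct (path_colors cv es p)) \<and>
     (\<forall>v\<in>set [0..<length cv]. \<forall>u\<in>set [0..<v].
        edge_color es u v \<noteq> None \<or> (\<exists>p\<in>set ps. hd p = u \<and> last p = v))"

definition list_edges :: "'a list \<Rightarrow> ((nat \<times> nat) \<times> nat) list \<Rightarrow> 'a set set" where
  "list_edges vs es = (\<lambda>((a, b), x). {vs ! a, vs ! b}) ` set es"

text \<open>The vertex \<open>vs ! i\<close> plays the role of \<open>i\<close>.\<close>

definition list_coloring ::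
    "'a list \<Rightarrow> nat list \<Rightarrow> ((nat \<times> nat) \<times> nat) list \<Rightarrow> 'a + 'a set \<Rightarrow> nat" where
  "list_coloring vs cv es x =
     (let g = the_inv_into {..<length vs} ((!) vs) in
      case x of Inl v \<Rightarrow> cv ! g v | Inr e \<Rightarrow> the (map_of es (Min (g ` e), Max (g ` e))))"

lemma the_inv_into_nth:
  "distinct vs \<Longrightarrow> i < length vs \<Longrightarrow> the_inv_into {..<length vs} ((!) vs) (vs ! i) = i"
  by (rule the_inv_into_f_f) (auto simp: inj_on_def nth_eq_iff_index_eq)

lemma list_coloring_simps:
  assumes "distinct vs"
  shows "i < length vs \<Longrightarrow> list_coloring vs cv es (Inl (vs ! i)) = cv ! i"
    and "i < length vs \<Longrightarrow> j < length vs \<Longrightarrow>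
      list_coloring vs cv es (Inr {vs ! i, vs ! j}) = the (edge_color es i j)"
  using assms by (simp_all add: list_coloring_def the_inv_into_nth edge_color_def)

lemma edge_color_in_list_edges: "edge_color es i j \<noteq> None \<Longrightarrow> {vs ! i, vs ! j} \<in> list_edges vs es"
  by (force simp: edge_color_def list_edges_def min_def max_def insert_commute
      dest!: map_of_SomeD split: if_splits)

lemma path_edges_list:
  "successively (\<lambda>u v. edge_color es u v \<noteq> None) p \<Longrightarrow>
     set (path_edges (map ((!) vs) p)) \<subseteq> list_edges vs es"
proof (induction p rule: induct_list012)
  case (3 x y zs)
  then show ?case using edge_color_in_list_edges[of es x y vs] by simp
qed auto

lemma edge_colors_list:
  "distinct vs \<Longrightarrow> \<forall>v\<in>set p. v < length vs \<Longrightarrow>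
     map (\<lambda>e. list_coloring vs cv es (Inr e)) (path_edges (map ((!) vs) p))
       = map2 (\<lambda>u v. the (edge_color es u v)) p (tl p)"
  by (induction p rule: induct_list012) (auto simp: list_coloring_simps)

lemma internal_vertices_map: "internal_vertices (map f p) = map f (internal_vertices p)"
  by (simp add: internal_vertices_def map_butlast map_tl)

text \<open>Reduces rainbowness of a path in the graph to distinctness of a computed list of
  numbers.\<close>

lemma list_coloring_path_colors:
  assumes "distinct vs" "\<forall>v\<in>set p. v < length vs"
  shows "map (list_coloring vs cv es)
      (map Inl (internal_vertices (map ((!) vs) p)) @ map Inr (path_edges (map ((!) vs) p)))
    = path_colors cv es p"
proof -
  have "set (internal_vertices p) \<subseteq> set p"
    by (metis internal_vertices_def in_set_butlastD list.set_sel(2) subsetI tl_Nil)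
  then show ?thesis
    using assms edge_colors_list[OF assms, of cv es]
    by (auto simp: path_colors_def internal_vertices_map list_coloring_simps comp_def)
qed

lemma list_path:
  assumes "distinct vs" "p \<noteq> []" "distinct p" "\<forall>v\<in>set p. v < length vs"
    "successively (\<lambda>u v. edge_color es u v \<noteq> None) p"
  shows "path_between (set vs) (list_edges vs es) (vs ! hd p) (map ((!) vs) p) (vs ! last p)"
  using assms path_edges_list[OF assms(5), of vs]
  by (auto simp: path_between_def is_path_def successively_edges_iff distinct_map hd_map last_map
      inj_on_def nth_eq_iff_index_eq)

lemma list_coloring_bound:
  assumes "distinct vs" "length cv = length vs" "coloring_certificate cv es ps k"
  shows "list_coloring vs cv es ` elements (set vs) (list_edges vs es) \<subseteq> {..<k}"
proof -
  have "list_coloring vs cv es (Inl v) < k" if v: "v \<in> set vs" for v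
  proof -
    obtain i where i: "i < length vs" "v = vs ! i" using v by (auto simp: in_set_conv_nth)
    then have "cv ! i \<in> set cv" using assms(2) by simp
    then show ?thesis using i assms(1,3) by (simp add: list_coloring_simps coloring_certificate_def)
  qed
  moreover have "list_coloring vs cv es (Inr e) < k" if e: "e \<in> list_edges vs es" for e
  proof -
    obtain a b x where ab: "((a, b), x) \<in> set es" "e = {vs ! a, vs ! b}"
      using e by (auto simp: list_edges_def)
    then have lt: "a < b" "b < length vs" using assms by (auto simp: coloring_certificate_def)
    obtain y where y: "map_of es (a, b) = Some y"
      using ab(1) by (metis domD map_of_eq_None_iff domIff image_eqI fst_conv)
    then have "((a, b), y) \<in> set es" by (rule map_of_SomeD)
    then have "y < k" using assms(3) by (auto simp: coloring_certificate_def)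
    then show ?thesis
      using ab(2) lt y assms(1) by (simp add: list_coloring_simps edge_color_def)
  qed
  ultimately show ?thesis by (auto simp: elements_def)
qed

lemma list_coloring_connected:
  assumes vs: "distinct vs" "length cv = length vs" and cert: "coloring_certificate cv es ps k"
  shows "total_rainbow_connected (set vs) (list_edges vs es) (list_coloring vs cv es)"
proof -
  let ?c = "list_coloring vs cv es" and ?F = "list_edges vs es"
  have half: "\<exists>p. path_between (set vs) ?F (vs ! i) p (vs ! j) \<and> total_rainbow ?c p"
    if ij: "i < j" "j < length vs" for i j
  proof (cases "edge_color es i j = None")
    case False
    have "path_between (set vs) ?F (vs ! i) [vs ! i, vs ! j] (vs ! j)"
      using edge_color_in_list_edges[OF False, of vs] ij vs(1)
      by (intro path_between_edge) (auto simp: nth_eq_iff_index_eq)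
    then show ?thesis by (intro exI[of _ "[vs ! i, vs ! j]"]) simp
  next
    case True
    moreover have "\<forall>v\<in>set [0..<length cv]. \<forall>u\<in>set [0..<v].
        edge_color es u v \<noteq> None \<or> (\<exists>p\<in>set ps. hd p = u \<and> last p = v)"
      using cert unfolding coloring_certificate_def by blast
    then have "edge_color es i j \<noteq> None \<or> (\<exists>p\<in>set ps. hd p = i \<and> last p = j)"
      using ij vs(2) by simp
    ultimately obtain p where p: "p \<in> set ps" "hd p = i" "last p = j" by auto
    then have q: "p \<noteq> []" "distinct p" "\<forall>v\<in>set p. v < length vs"
      "successively (\<lambda>u v. edge_color es u v \<noteq> None) p" "distinct (path_colors cv es p)"
      using cert vs(2) by (auto simp: coloring_certificate_def)
    let ?l = "map Inl (internal_vertices (map ((!) vs) p)) @ map Inr (path_edges (map ((!) vs) p))"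
    have "distinct (map ?c ?l)"
      using q(5) list_coloring_path_colors[OF vs(1) q(3), of cv es] by simp
    then have "inj_on ?c (set ?l)" using distinct_map by blast
    then have "total_rainbow ?c (map ((!) vs) p)" by (simp add: total_rainbow_def)
    then show ?thesis using list_path[OF vs(1) q(1-4)] p by auto
  qed
  have "\<exists>p. path_between (set vs) ?F u p v \<and> total_rainbow ?c p"
    if uv: "u \<in> set vs" "v \<in> set vs" "u \<noteq> v" for u v
  proof -
    obtain i j where ij: "u = vs ! i" "v = vs ! j" "i < length vs" "j < length vs"
      using uv by (auto simp: in_set_conv_nth)
    then consider "i < j" | "j < i" using uv by fastforce
    then show ?thesis
    proof cases
      case 1
      then show ?thesis using half[of i j] ij by simp
    next
      case 2
      then obtain p where "path_between (set vs) ?F v p u" "total_rainbow ?c p"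
        using half[of j i] ij by auto
      then show ?thesis by (intro exI[of _ "rev p"] conjI path_between_rev total_rainbow_rev)
    qed
  qed
  then show ?thesis by (simp add: total_rainbow_connected_def)
qed

text \<open>The certified graph is a subgraph of the given one and need not be induced, so further
  edges between the listed vertices do no harm.\<close>

lemma colorable_certificate:
  assumes G: "simple_graph V E" "connected_graph V E"
    and vs: "distinct vs" "set vs \<subseteq> V" "length cv = length vs" "vs \<noteq> []"
    and F: "list_edges vs es \<subseteq> E"
    and cert: "coloring_certificate cv es ps k" "0 < k"
  shows "colorable V E (k + 2 * (card V - length vs))"
proof -
  have "colorable (set vs) (list_edges vs es) k"
    using list_coloring_connected[OF vs(1,3) cert(1)] list_coloring_bound[OF vs(1,3) cert(1)]
    by (auto simp: colorable_def)
  moreover have "\<Union>(list_edges vs es) \<subseteq> set vs"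
  proof -
    have "a < length vs \<and> b < length vs" if "((a, b), x) \<in> set es" for a b x
      using that cert(1) vs(3) by (fastforce simp: coloring_certificate_def)
    then show ?thesis by (fastforce simp: list_edges_def)
  qed
  ultimately have "colorable V E (k + 2 * (card V - card (set vs)))"
    using vs F cert(2) by (intro colorable_supergraph[OF G]) auto
  then show ?thesis using vs(1) by (simp add: distinct_card)
qed

definition good :: "'a set \<Rightarrow> 'a set set \<Rightarrow> bool" where
  "good V E \<longleftrightarrow> colorable V E (2 * card V - 9)"

text \<open>The excess of twice the order over the number of colors is preserved by growth, so it
  suffices that the listed subgraph has excess \<open>9\<close>.\<close>

lemma good_certificate:
  assumes G: "simple_graph V E" "connected_graph V E"
    and vs: "distinct vs" "set vs \<subseteq> V"
    and F: "list_edges vs es \<subseteq> E"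
    and cert: "length cv = length vs" "coloring_certificate cv es ps k" "0 < k" "k + 9 = 2 * length vs"
  shows "good V E"
proof -
  have "length vs \<le> card V"
    using vs G(1) by (metis card_mono distinct_card simple_graph_def)
  then have "k + 2 * (card V - length vs) = 2 * card V - 9" using cert(4) by linarith
  then show ?thesis
    using colorable_certificate[OF G vs cert(1) _ F cert(2,3)] cert(4) unfolding good_def by fastforce
qed

section \<open>Branching at a vertex\<close>

text \<open>A coloring with two spare colors at \<open>u\<close>: they may be given to two pendant edges at \<open>u\<close>.\<close>

definition branchable :: "'a set \<Rightarrow> 'a set set \<Rightarrow> 'a \<Rightarrow> nat \<Rightarrow> bool" where
  "branchable A F u k \<longleftrightarrow> (\<exists>c \<alpha> \<beta>. total_rainbow_connected A F c \<and> c ` elements A F \<subseteq> {..<k} \<and>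
     \<alpha> < k \<and> \<beta> < k \<and> \<alpha> \<noteq> \<beta> \<and> c (Inl u) \<noteq> \<alpha> \<and> c (Inl u) \<noteq> \<beta> \<and>
     (\<forall>x\<in>A - {u}. \<forall>\<gamma>\<in>{\<alpha>, \<beta>}. \<exists>p. path_between A F x p u \<and>
        inj_on c (Inl ` set (tl p) \<union> Inr ` set (path_edges p)) \<and>
        \<gamma> \<notin> c ` (Inl ` set (tl p) \<union> Inr ` set (path_edges p))))"

text \<open>The new edge and the new vertex take fresh colors, so the two spare colors remain spare
  one step further along the tail.\<close>

lemma branchable_extend:
  assumes br: "branchable A F u k" and u: "u \<in> A" and w: "w \<notin> A" and F: "\<Union>F \<subseteq> A"
  shows "branchable (insert w A) (insert {u, w} F) w (k + 2)"
proof -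
  obtain c \<alpha> \<beta> where c: "total_rainbow_connected A F c" "c ` elements A F \<subseteq> {..<k}"
    and ab: "\<alpha> < k" "\<beta> < k" "\<alpha> \<noteq> \<beta>"
    and path: "\<And>x \<gamma>. x \<in> A - {u} \<Longrightarrow> \<gamma> \<in> {\<alpha>, \<beta>} \<Longrightarrow> \<exists>p. path_between A F x p u \<and>
        inj_on c (Inl ` set (tl p) \<union> Inr ` set (path_edges p)) \<and>
        \<gamma> \<notin> c ` (Inl ` set (tl p) \<union> Inr ` set (path_edges p))"
    using br unfolding branchable_def by metis
  let ?A = "insert w A" and ?F = "insert {u, w} F"
  \<comment> \<open>Here \<open>u\<close> keeps its color, which the paths to \<open>u\<close>
    already count. The fresh vertex color goes to \<open>w\<close>, which becomes internal when the
    tail is continued or branches.\<close>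
  define c' where "c' = c(Inr {u, w} := k, Inl w := k + 1)"
  have c'_new: "c' (Inr {u, w}) = k" "c' (Inl w) = k + 1" by (auto simp: c'_def)
  have c'_old: "c' x = c x \<and> c x < k" if "x \<in> elements A F" for x
  proof
    show "c x < k" using that c(2) by blast
    show "c' x = c x" using that w F by (auto simp: c'_def elements_def)
  qed
  have edge: "path_between ?A ?F u [u, w] w" by (rule path_between_edge) (use u w in auto)
  have old: "\<exists>p. path_between ?A ?F x p y \<and> total_rainbow c' p"
    if xy: "x \<in> A" "y \<in> A" "x \<noteq> y" for x y
  proof -
    obtain p where p: "path_between A F x p y" "total_rainbow c p"
      using c(1) xy by (auto simp: total_rainbow_connected_def)
    have "total_rainbow c' p"
    proof (rule total_rainbow_cong[OF p(2)])
      fix a assume "a \<in> Inl ` set (internal_vertices p) \<union> Inr ` set (path_edges p)"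
      then have "a \<in> elements A F"
        using path_betweenD[OF p(1)] by (auto simp: elements_def set_internal_vertices)
      then show "c' a = c a" using c'_old by blast
    qed
    moreover have "path_between ?A ?F x p y" by (rule path_between_mono[OF p(1)]) auto
    ultimately show ?thesis by blast
  qed
  have new: "\<exists>p. path_between ?A ?F x p w \<and> total_rainbow c' p \<and>
        inj_on c' (Inl ` set (tl p) \<union> Inr ` set (path_edges p)) \<and>
        \<gamma> \<notin> c' ` (Inl ` set (tl p) \<union> Inr ` set (path_edges p))"
    if x: "x \<in> A" and g: "\<gamma> \<in> {\<alpha>, \<beta>}" for x \<gamma>
  proof (cases "x = u")
    case True
    then show ?thesis using edge c'_new ab g by (intro exI[of _ "[u, w]"]) auto
  next
    case False
    then obtain p where p: "path_between A F x p u"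
        "inj_on c (Inl ` set (tl p) \<union> Inr ` set (path_edges p))"
        "\<gamma> \<notin> c ` (Inl ` set (tl p) \<union> Inr ` set (path_edges p))"
      using path[of x \<gamma>] x g by auto
    note pd = path_betweenD[OF p(1)]
    define X where "X = Inl ` set (tl p) \<union> Inr ` set (path_edges p)"
    have X: "X \<subseteq> elements A F"
      using pd by (auto simp: X_def elements_def set_tl_path)
    have cX: "c' a = c a" "c a < k" if "a \<in> X" for a
      using c'_old[of a] X that by blast+
    have inj: "inj_on c' X"
      using p(2) cX unfolding X_def[symmetric] by (metis (no_types, lifting) inj_on_cong)
    have fresh: "k \<notin> c' ` X" "k + 1 \<notin> c' ` X" using cX by fastforce+
    have g': "\<gamma> \<notin> c' ` X" using p(3) cX unfolding X_def[symmetric] by auto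
    have "total_rainbow c' (p @ [w])"
      using pd c'_new inj fresh by (intro total_rainbow_snoc) (auto simp: X_def)
    moreover have "path_between ?A ?F x (p @ [w]) w"
    proof (rule path_between_snoc)
      show "path_between ?A ?F x p u" by (rule path_between_mono[OF p(1)]) auto
    qed (use pd w in auto)
    moreover have "Inl ` set (tl (p @ [w])) \<union> Inr ` set (path_edges (p @ [w]))
        = insert (Inl w) (insert (Inr {u, w}) X)"
      using pd by (auto simp: X_def path_edges_snoc)
    moreover have "Inl w \<notin> X" "Inr {u, w} \<notin> X" using pd w F by (auto simp: X_def set_tl_path)
    then have "inj_on c' (insert (Inl w) (insert (Inr {u, w}) X))"
      using inj fresh c'_new by auto
    moreover have "\<gamma> \<notin> c' ` insert (Inl w) (insert (Inr {u, w}) X)"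
      using g' c'_new ab g by auto
    ultimately show ?thesis by (intro exI[of _ "p @ [w]"]) simp
  qed
  have "total_rainbow_connected ?A ?F c'"
    by (rule total_rainbow_connectedI[OF old]) (use new in blast)+
  moreover have "c' ` elements ?A ?F \<subseteq> {..<k + 2}"
  proof
    fix y assume "y \<in> c' ` elements ?A ?F"
    then obtain x where x: "y = c' x" "x \<in> elements ?A ?F" by auto
    then consider "x = Inl w" | "x = Inr {u, w}" | "x \<in> elements A F"
      by (auto simp: elements_def)
    then show "y \<in> {..<k + 2}" using c'_new c'_old[of x] x by cases auto
  qed
  moreover have "\<forall>x\<in>?A - {w}. \<forall>\<gamma>\<in>{\<alpha>, \<beta>}. \<exists>p. path_between ?A ?F x p w \<and>
        inj_on c' (Inl ` set (tl p) \<union> Inr ` set (path_edges p)) \<and>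
        \<gamma> \<notin> c' ` (Inl ` set (tl p) \<union> Inr ` set (path_edges p))"
    using new by (metis Diff_iff insert_iff)
  ultimately show ?thesis
    unfolding branchable_def using ab c'_new
    by (intro exI[of _ c'] exI[of _ \<alpha>] exI[of _ \<beta>]) auto
qed

text \<open>Spending the spare colors on the two pendant edges adds two vertices without any new
  color, a gain of four over attaching them separately.\<close>

lemma branchable_pendants:
  assumes br: "branchable A F u k" and u: "u \<in> A" and F: "\<Union>F \<subseteq> A"
    and w: "w \<notin> A" "w' \<notin> A" "w \<noteq> w'"
  shows "colorable (insert w (insert w' A)) (insert {u, w} (insert {u, w'} F)) k"
proof -
  obtain c \<alpha> \<beta> where c: "total_rainbow_connected A F c" "c ` elements A F \<subseteq> {..<k}"
    and ab: "\<alpha> < k" "\<beta> < k" "\<alpha> \<noteq> \<beta>" "c (Inl u) \<noteq> \<alpha>" "c (Inl u) \<noteq> \<beta>"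
    and path: "\<And>x \<gamma>. x \<in> A - {u} \<Longrightarrow> \<gamma> \<in> {\<alpha>, \<beta>} \<Longrightarrow> \<exists>p. path_between A F x p u \<and>
        inj_on c (Inl ` set (tl p) \<union> Inr ` set (path_edges p)) \<and>
        \<gamma> \<notin> c ` (Inl ` set (tl p) \<union> Inr ` set (path_edges p))"
    using br unfolding branchable_def by metis
  let ?A = "insert w (insert w' A)" and ?F = "insert {u, w} (insert {u, w'} F)"
  \<comment> \<open>The new vertices are never internal, and any old color would do for them. The
    path from \<open>w'\<close> to \<open>w\<close> is rainbow because \<open>\<alpha>\<close>,
    \<open>\<beta>\<close> and the color of \<open>u\<close> differ.\<close>
  define c' where "c' = c(Inr {u, w} := \<alpha>, Inr {u, w'} := \<beta>, Inl w := \<alpha>, Inl w' := \<alpha>)"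
  have uw: "u \<noteq> w" "u \<noteq> w'" using u w by auto
  have c'_new: "c' (Inr {u, w}) = \<alpha>" "c' (Inr {u, w'}) = \<beta>" "c' (Inl w) = \<alpha>" "c' (Inl w') = \<alpha>"
    using uw w(3) by (auto simp: c'_def doubleton_eq_iff)
  have c'_old: "c' x = c x \<and> c x < k" if "x \<in> elements A F" for x
  proof
    show "c x < k" using that c(2) by blast
    show "c' x = c x" using that w F by (auto simp: c'_def elements_def)
  qed
  have old: "\<exists>p. path_between ?A ?F x p y \<and> total_rainbow c' p"
    if xy: "x \<in> A" "y \<in> A" "x \<noteq> y" for x y
  proof -
    obtain p where p: "path_between A F x p y" "total_rainbow c p"
      using c(1) xy by (auto simp: total_rainbow_connected_def)
    have "total_rainbow c' p"
    proof (rule total_rainbow_cong[OF p(2)])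
      fix a assume "a \<in> Inl ` set (internal_vertices p) \<union> Inr ` set (path_edges p)"
      then have "a \<in> elements A F"
        using path_betweenD[OF p(1)] by (auto simp: elements_def set_internal_vertices)
      then show "c' a = c a" using c'_old by blast
    qed
    moreover have "path_between ?A ?F x p y" by (rule path_between_mono[OF p(1)]) auto
    ultimately show ?thesis by blast
  qed
  have new: "\<exists>p. path_between ?A ?F x p z \<and> total_rainbow c' p"
    if x: "x \<in> A" and z: "z \<in> {w, w'}" for x z
  proof (cases "x = u")
    case True
    have "path_between ?A ?F u [u, z] z" by (rule path_between_edge) (use u uw z in auto)
    then show ?thesis using True by (intro exI[of _ "[u, z]"]) simp
  next
    case False
    define \<gamma> where "\<gamma> = c' (Inr {u, z})"
    have "\<gamma> \<in> {\<alpha>, \<beta>}" using z c'_new by (auto simp: \<gamma>_def)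
    then obtain p where p: "path_between A F x p u"
        "inj_on c (Inl ` set (tl p) \<union> Inr ` set (path_edges p))"
        "\<gamma> \<notin> c ` (Inl ` set (tl p) \<union> Inr ` set (path_edges p))"
      using path[of x \<gamma>] x False by auto
    note pd = path_betweenD[OF p(1)]
    define X where "X = Inl ` set (tl p) \<union> Inr ` set (path_edges p)"
    have X: "X \<subseteq> elements A F"
      using pd by (auto simp: X_def elements_def set_tl_path)
    have cX: "c' a = c a" if "a \<in> X" for a
      using c'_old[of a] X that by blast
    have inj: "inj_on c' X"
      using p(2) cX unfolding X_def[symmetric] by (metis (no_types, lifting) inj_on_cong)
    have "\<gamma> \<notin> c' ` X" using p(3) cX unfolding X_def[symmetric] by auto
    then have "total_rainbow c' (p @ [z])"
      using pd inj by (intro total_rainbow_snoc) (auto simp: X_def \<gamma>_def)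
    moreover have "path_between ?A ?F x (p @ [z]) z"
    proof (rule path_between_snoc)
      show "path_between ?A ?F x p u" by (rule path_between_mono[OF p(1)]) auto
    qed (use pd w z in auto)
    ultimately show ?thesis by blast
  qed
  have "path_between ?A ?F w' ([w', u] @ [w]) w"
  proof (rule path_between_snoc)
    show "path_between ?A ?F w' [w', u] u"
      by (rule path_between_edge) (use u uw in \<open>auto simp: insert_commute\<close>)
  qed (use uw w in auto)
  moreover have "total_rainbow c' [w', u, w]"
  proof -
    have "c' (Inl u) = c (Inl u)" using c'_old[of "Inl u"] u by (simp add: elements_def)
    then show ?thesis
      using c'_new ab uw w(3)
      by (auto simp: total_rainbow_def internal_vertices_def insert_commute doubleton_eq_iff)
  qed
  ultimately have ww: "\<exists>p. path_between ?A ?F w' p w \<and> total_rainbow c' p"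
    by (intro exI[of _ "[w', u, w]"]) simp
  have w'conn: "\<exists>p. path_between ?A ?F x p y \<and> total_rainbow c' p"
    if xy: "x \<in> insert w' A" "y \<in> insert w' A" "x \<noteq> y" for x y
  proof (cases "x = w'")
    case True
    then obtain p where "path_between ?A ?F y p x" "total_rainbow c' p"
      using new[of y w'] xy by auto
    then show ?thesis by (intro exI[of _ "rev p"] conjI path_between_rev total_rainbow_rev)
  next
    case False
    then show ?thesis using old[of x y] new[of x w'] xy by (cases "y = w'") auto
  qed
  have "total_rainbow_connected ?A ?F c'"
    by (rule total_rainbow_connectedI[OF w'conn]) (use new[of _ w] ww in auto)
  moreover have "c' ` elements ?A ?F \<subseteq> {..<k}"
  proof
    fix y assume "y \<in> c' ` elements ?A ?F"
    then obtain x where x: "y = c' x" "x \<in> elements ?A ?F" by auto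
    then consider "x = Inl w" | "x = Inr {u, w}" | "x = Inl w'" | "x = Inr {u, w'}" | "x \<in> elements A F"
      by (auto simp: elements_def)
    then show "y \<in> {..<k}" using c'_new c'_old[of x] ab x by cases auto
  qed
  ultimately show ?thesis unfolding colorable_def by blast
qed

text \<open>The paths in \<open>qs\<close> lead to the branching vertex \<open>0\<close>, whose own
  color counts, since it becomes internal once a pendant edge is appended. The path may depend on
  the color to be avoided: in the hexagon, the vertex opposite to \<open>0\<close> avoids one spare
  color on either way round.\<close>

definition branch_certificate :: "nat list \<Rightarrow> ((nat \<times> nat) \<times> nat) list \<Rightarrow> nat list list \<Rightarrow>
    nat list list \<Rightarrow> nat \<Rightarrow> nat \<Rightarrow> nat \<Rightarrow> bool" where
  "branch_certificate cv es ps qs \<alpha> \<beta> k \<longleftrightarrow>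
     coloring_certificate cv es ps k \<and> \<alpha> < k \<and> \<beta> < k \<and> \<alpha> \<noteq> \<beta> \<and> cv ! 0 \<noteq> \<alpha> \<and> cv ! 0 \<noteq> \<beta> \<and>
     (\<forall>q\<in>set qs. q \<noteq> [] \<and> distinct q \<and> (\<forall>v\<in>set q. v < length cv) \<and>
        successively (\<lambda>u v. edge_color es u v \<noteq> None) q) \<and>
     (\<forall>i\<in>set [1..<length cv]. \<forall>\<gamma>\<in>set [\<alpha>, \<beta>]. \<exists>q\<in>set qs. hd q = i \<and> last q = 0 \<and>
        distinct (\<gamma> # map ((!) cv) (tl q) @ map2 (\<lambda>u v. the (edge_color es u v)) q (tl q)))"

lemma branchable_certificate:
  assumes vs: "distinct vs" "length cv = length vs" "vs \<noteq> []"
    and cert: "branch_certificate cv es ps qs \<alpha> \<beta> k"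
  shows "branchable (set vs) (list_edges vs es) (hd vs) k"
proof -
  let ?c = "list_coloring vs cv es" and ?F = "list_edges vs es"
  have cert': "coloring_certificate cv es ps k" using cert by (simp add: branch_certificate_def)
  have hd: "hd vs = vs ! 0" using vs by (simp add: hd_conv_nth)
  have "\<exists>p. path_between (set vs) ?F x p (hd vs) \<and>
        inj_on ?c (Inl ` set (tl p) \<union> Inr ` set (path_edges p)) \<and>
        \<gamma> \<notin> ?c ` (Inl ` set (tl p) \<union> Inr ` set (path_edges p))"
    if x: "x \<in> set vs - {hd vs}" and g: "\<gamma> \<in> {\<alpha>, \<beta>}" for x \<gamma>
  proof -
    obtain i where i: "x = vs ! i" "i < length vs" using x by (auto simp: in_set_conv_nth)
    then have "i \<noteq> 0" using x hd by (cases i) auto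
    then have "i \<in> set [1..<length cv]" using i vs by simp
    moreover have "\<forall>i\<in>set [1..<length cv]. \<forall>\<gamma>\<in>set [\<alpha>, \<beta>]. \<exists>q\<in>set qs. hd q = i \<and> last q = 0 \<and>
        distinct (\<gamma> # map ((!) cv) (tl q) @ map2 (\<lambda>u v. the (edge_color es u v)) q (tl q))"
      using cert unfolding branch_certificate_def by blast
    moreover have "\<gamma> \<in> set [\<alpha>, \<beta>]" using g by auto
    ultimately obtain q where q: "q \<in> set qs" "hd q = i" "last q = 0"
        "distinct (\<gamma> # map ((!) cv) (tl q) @ map2 (\<lambda>u v. the (edge_color es u v)) q (tl q))"
      by blast
    have q': "q \<noteq> []" "distinct q" "\<forall>v\<in>set q. v < length vs"
        "successively (\<lambda>u v. edge_color es u v \<noteq> None) q"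
      using q(1) cert vs(2) unfolding branch_certificate_def by auto
    let ?p = "map ((!) vs) q"
    let ?l = "map Inl (tl ?p) @ map Inr (path_edges ?p)"
    have "map ?c (map Inl (tl ?p)) = map ((!) cv) (tl q)"
      using q'(3) list.set_sel(2)[of q] vs(1)
      by (cases q) (auto simp: list_coloring_simps)
    moreover have "map ?c (map Inr (path_edges ?p))
        = map2 (\<lambda>u v. the (edge_color es u v)) q (tl q)"
      using edge_colors_list[OF vs(1) q'(3), of cv es] by (simp add: comp_def)
    ultimately have "distinct (\<gamma> # map ?c ?l)" using q(4) by simp
    then have "inj_on ?c (set ?l)" "\<gamma> \<notin> ?c ` set ?l"
      unfolding distinct.simps distinct_map by auto
    moreover have "set ?l = Inl ` set (tl ?p) \<union> Inr ` set (path_edges ?p)" by simp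
    ultimately show ?thesis
      using list_path[OF vs(1) q'] q(2,3) i hd by (intro exI[of _ ?p]) simp
  qed
  moreover have "?c (Inl (hd vs)) = cv ! 0" using vs hd by (simp add: list_coloring_simps)
  ultimately show ?thesis
    unfolding branchable_def
    using list_coloring_connected[OF vs(1,2) cert'] list_coloring_bound[OF vs(1,2) cert'] cert
    by (intro exI[of _ ?c] exI[of _ \<alpha>] exI[of _ \<beta>]) (auto simp: branch_certificate_def)
qed

text \<open>The colorings below were found with a SAT solver. The vertices are numbered along the cycle,
  followed by those outside it.\<close>

lemma branch_certificate_C6:
  "branch_certificate [0, 1, 2, 0, 3, 1]
    [((0, 1), 3), ((0, 5), 5), ((1, 2), 6), ((2, 3), 5), ((3, 4), 4), ((4, 5), 6)]
    [[0, 1, 2], [0, 1, 2, 3], [1, 2, 3], [0, 5, 4], [1, 0, 5, 4], [2, 3, 4], [1, 0, 5],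
     [2, 1, 0, 5], [3, 4, 5]]
    [[1, 0], [2, 1, 0], [3, 2, 1, 0], [3, 4, 5, 0], [4, 5, 0], [5, 0]] 4 2 7"
  by code_simp

section \<open>Certificates for cycles of length \<open>7\<close> and \<open>8\<close>\<close>

lemma certificate_C8:
  "coloring_certificate [0, 1, 2, 3, 1, 2, 1, 2]
    [((0, 1), 4), ((0, 7), 3), ((1, 2), 5), ((2, 3), 6), ((3, 4), 0), ((4, 5), 4), ((5, 6), 5),
     ((6, 7), 6)]
    [[0, 1, 2], [0, 1, 2, 3], [1, 2, 3], [0, 1, 2, 3, 4], [1, 2, 3, 4], [2, 3, 4], [0, 7, 6, 5],
     [1, 0, 7, 6, 5], [2, 3, 4, 5], [3, 4, 5], [0, 7, 6], [1, 0, 7, 6], [2, 1, 0, 7, 6],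
     [3, 4, 5, 6], [4, 5, 6], [1, 0, 7], [2, 1, 0, 7], [3, 2, 1, 0, 7], [4, 5, 6, 7], [5, 6, 7]] 7"
  by code_simp

lemma certificate_C7_pendant:
  "coloring_certificate [0, 1, 2, 3, 4, 3, 5, 3]
    [((0, 1), 3), ((0, 6), 2), ((0, 7), 4), ((1, 2), 6), ((2, 3), 5), ((3, 4), 0), ((4, 5), 1),
     ((5, 6), 6)]
    [[0, 1, 2], [0, 1, 2, 3], [1, 2, 3], [0, 6, 5, 4], [1, 2, 3, 4], [2, 3, 4], [0, 6, 5],
     [1, 0, 6, 5], [2, 3, 4, 5], [3, 4, 5], [1, 0, 6], [2, 1, 0, 6], [3, 4, 5, 6], [4, 5, 6],
     [1, 0, 7], [2, 1, 0, 7], [3, 2, 1, 0, 7], [4, 5, 6, 0, 7], [5, 6, 0, 7], [6, 0, 7]] 7"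
  by code_simp

lemma certificate_C7_chord2:
  "coloring_certificate [0, 1, 2, 1, 2, 0, 3]
    [((0, 1), 4), ((0, 2), 4), ((0, 6), 1), ((1, 2), 4), ((2, 3), 3), ((3, 4), 0), ((4, 5), 4),
     ((5, 6), 2)]
    [[0, 2, 3], [1, 2, 3], [0, 2, 3, 4], [1, 2, 3, 4], [2, 3, 4], [0, 6, 5], [1, 0, 6, 5],
     [2, 0, 6, 5], [3, 4, 5], [1, 0, 6], [2, 0, 6], [3, 2, 0, 6], [4, 5, 6]] 5"
  by code_simp

lemma certificate_C7_chord3:
  "coloring_certificate [0, 1, 2, 3, 1, 4, 2]
    [((0, 1), 4), ((0, 3), 1), ((0, 6), 3), ((1, 2), 2), ((2, 3), 4), ((3, 4), 2), ((4, 5), 0),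
     ((5, 6), 1)]
    [[0, 1, 2], [1, 0, 3], [0, 3, 4], [1, 0, 3, 4], [2, 3, 4], [0, 6, 5], [1, 0, 6, 5],
     [2, 3, 4, 5], [3, 4, 5], [1, 0, 6], [2, 1, 0, 6], [3, 0, 6], [4, 5, 6]] 5"
  by code_simp

section \<open>Certificates for hexagons with pendant edges, ears and chords\<close>

lemma certificate_C6:
  "coloring_certificate [0, 1, 0, 2, 0, 2]
    [((0, 1), 3), ((0, 5), 4), ((1, 2), 2), ((2, 3), 4), ((3, 4), 3), ((4, 5), 1)]
    [[0, 1, 2], [0, 1, 2, 3], [1, 2, 3], [0, 5, 4], [1, 0, 5, 4], [2, 3, 4], [1, 0, 5],
     [2, 1, 0, 5], [3, 4, 5]] 5"
  by code_simp

lemma certificate_C6_pendants1: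
  "coloring_certificate [0, 1, 2, 0, 3, 4, 2, 0]
    [((0, 1), 5), ((0, 5), 2), ((0, 6), 6), ((1, 2), 4), ((1, 7), 3), ((2, 3), 6), ((3, 4), 5),
     ((4, 5), 1)]
    [[0, 1, 2], [0, 1, 2, 3], [1, 2, 3], [0, 5, 4], [1, 0, 5, 4], [2, 3, 4], [1, 0, 5],
     [2, 1, 0, 5], [3, 4, 5], [1, 0, 6], [2, 1, 0, 6], [3, 4, 5, 0, 6], [4, 5, 0, 6], [5, 0, 6],
     [0, 1, 7], [2, 1, 7], [3, 2, 1, 7], [4, 3, 2, 1, 7], [5, 0, 1, 7], [6, 0, 1, 7]] 7"
  by code_simp

lemma certificate_C6_pendants2:
  "coloring_certificate [0, 1, 2, 0, 1, 2, 3, 4]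
    [((0, 1), 3), ((0, 5), 5), ((0, 6), 6), ((1, 2), 4), ((2, 3), 6), ((2, 7), 5), ((3, 4), 3),
     ((4, 5), 4)]
    [[0, 1, 2], [0, 1, 2, 3], [1, 2, 3], [0, 5, 4], [1, 0, 5, 4], [2, 3, 4], [1, 0, 5],
     [2, 1, 0, 5], [3, 4, 5], [1, 0, 6], [2, 1, 0, 6], [3, 4, 5, 0, 6], [4, 5, 0, 6], [5, 0, 6],
     [0, 1, 2, 7], [1, 2, 7], [3, 2, 7], [4, 3, 2, 7], [5, 4, 3, 2, 7], [6, 0, 1, 2, 7]] 7"
  by code_simp

lemma certificate_C6_ear1:
  "coloring_certificate [0, 1, 2, 1, 0, 3, 2]
    [((0, 1), 3), ((0, 5), 2), ((0, 6), 4), ((1, 2), 4), ((1, 6), 3), ((2, 3), 0), ((3, 4), 3),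
     ((4, 5), 1)]
    [[0, 1, 2], [0, 1, 2, 3], [1, 2, 3], [0, 5, 4], [1, 2, 3, 4], [2, 3, 4], [1, 0, 5],
     [2, 1, 0, 5], [3, 4, 5], [2, 1, 6], [3, 2, 1, 6], [4, 5, 0, 6], [5, 0, 6]] 5"
  by code_simp

lemma certificate_C6_ear2:
  "coloring_certificate [0, 1, 2, 1, 3, 4, 0]
    [((0, 1), 2), ((0, 5), 1), ((0, 6), 3), ((1, 2), 3), ((2, 3), 4), ((2, 6), 1), ((3, 4), 0),
     ((4, 5), 2)]
    [[0, 1, 2], [0, 5, 4, 3], [1, 2, 3], [0, 5, 4], [1, 2, 3, 4], [2, 3, 4], [1, 0, 5],
     [2, 3, 4, 5], [3, 4, 5], [1, 0, 6], [3, 2, 6], [4, 5, 0, 6], [5, 0, 6]] 5"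
  by code_simp

lemma certificate_C6_ear3:
  "coloring_certificate [0, 1, 1, 2, 1, 2, 2]
    [((0, 1), 2), ((0, 5), 1), ((0, 6), 3), ((1, 2), 3), ((2, 3), 4), ((3, 4), 0), ((3, 6), 1),
     ((4, 5), 3)]
    [[0, 1, 2], [0, 6, 3], [1, 2, 3], [0, 5, 4], [1, 2, 3, 4], [2, 3, 4], [1, 0, 5], [2, 3, 4, 5],
     [3, 4, 5], [1, 0, 6], [2, 3, 6], [4, 3, 6], [5, 0, 6]] 5"
  by code_simp

lemma certificate_C6_long_ear:
  "coloring_certificate [0, 1, 0, 2, 3, 1, 4, 1]
    [((0, 1), 5), ((0, 5), 3), ((0, 6), 2), ((1, 2), 4), ((2, 3), 6), ((3, 4), 1), ((3, 7), 0),
     ((4, 5), 6), ((6, 7), 6)]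
    [[0, 1, 2], [0, 1, 2, 3], [1, 2, 3], [0, 5, 4], [1, 0, 5, 4], [2, 3, 4], [1, 0, 5],
     [2, 1, 0, 5], [3, 4, 5], [1, 0, 6], [2, 1, 0, 6], [3, 7, 6], [4, 5, 0, 6], [5, 0, 6],
     [0, 6, 7], [1, 0, 6, 7], [2, 3, 7], [4, 3, 7], [5, 0, 6, 7]] 7"
  by code_simp

lemma certificate_C6_pendant_chord02:
  "coloring_certificate [0, 1, 2, 0, 0, 2, 2]
    [((0, 1), 1), ((0, 2), 3), ((0, 5), 4), ((0, 6), 1), ((1, 2), 4), ((2, 3), 4), ((3, 4), 2),
     ((4, 5), 3)]
    [[0, 2, 3], [1, 0, 2, 3], [0, 5, 4], [1, 0, 5, 4], [2, 3, 4], [1, 0, 5], [2, 0, 5], [3, 4, 5],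
     [1, 2, 0, 6], [2, 0, 6], [3, 2, 0, 6], [4, 5, 0, 6], [5, 0, 6]] 5"
  by code_simp

lemma certificate_C6_pendant_chord13:
  "coloring_certificate [0, 1, 2, 2, 0, 3, 3]
    [((0, 1), 4), ((0, 5), 1), ((0, 6), 2), ((1, 2), 3), ((1, 3), 3), ((2, 3), 3), ((3, 4), 1),
     ((4, 5), 4)]
    [[0, 1, 2], [0, 1, 3], [0, 5, 4], [1, 3, 4], [2, 3, 4], [1, 0, 5], [2, 3, 4, 5], [3, 4, 5],
     [1, 0, 6], [2, 1, 0, 6], [3, 1, 0, 6], [4, 5, 0, 6], [5, 0, 6]] 5"
  by code_simp

lemma certificate_C6_pendant_chord03:
  "coloring_certificate [0, 1, 0, 1, 0, 2, 3]
    [((0, 1), 3), ((0, 3), 2), ((0, 5), 1), ((0, 6), 4), ((1, 2), 2), ((2, 3), 2), ((3, 4), 3),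
     ((4, 5), 4)]
    [[0, 1, 2], [1, 0, 3], [0, 3, 4], [1, 0, 5, 4], [2, 3, 4], [1, 0, 5], [2, 3, 4, 5], [3, 0, 5],
     [1, 0, 6], [2, 1, 0, 6], [3, 0, 6], [4, 3, 0, 6], [5, 0, 6]] 5"
  by code_simp

lemma certificate_C6_chords_02_14:
  "coloring_certificate [0, 1, 1, 1, 1, 2]
    [((0, 1), 2), ((0, 2), 2), ((0, 5), 1), ((1, 2), 2), ((1, 4), 1), ((2, 3), 0), ((3, 4), 2),
     ((4, 5), 0)]
    [[0, 2, 3], [1, 2, 3], [0, 5, 4], [2, 3, 4], [1, 0, 5], [2, 0, 5], [3, 4, 5]] 3"
  by code_simp

lemma certificate_C6_chords_02_24:
  "coloring_certificate [0, 1, 1, 0, 0, 1]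
    [((0, 1), 1), ((0, 2), 0), ((0, 5), 2), ((1, 2), 0), ((2, 3), 2), ((2, 4), 2), ((3, 4), 2),
     ((4, 5), 1)]
    [[0, 2, 3], [1, 2, 3], [0, 2, 4], [1, 2, 4], [1, 0, 5], [2, 4, 5], [3, 4, 5]] 3"
  by code_simp

lemma certificate_C6_chords_02_13:
  "coloring_certificate [0, 1, 0, 0, 1, 2]
    [((0, 1), 2), ((0, 2), 2), ((0, 5), 1), ((1, 2), 0), ((1, 3), 1), ((2, 3), 1), ((3, 4), 2),
     ((4, 5), 0)]
    [[0, 2, 3], [0, 5, 4], [1, 3, 4], [2, 3, 4], [1, 0, 5], [2, 0, 5], [3, 4, 5]] 3"
  by code_simp

text \<open>The hexagon with all three chords between opposite vertices; every listed path has just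
  two edges.\<close>

lemma certificate_K33:
  "coloring_certificate [0, 1, 2, 2, 2, 1]
    [((0, 1), 2), ((0, 3), 2), ((0, 5), 1), ((1, 2), 0), ((1, 4), 0), ((2, 3), 1), ((2, 5), 1),
     ((3, 4), 0), ((4, 5), 0)]
    [[0, 1, 2], [1, 2, 3], [0, 1, 4], [2, 3, 4], [1, 0, 5], [3, 0, 5]] 3"
  by code_simp

section \<open>Circuits\<close>

definition circuit_edges :: "'a list \<Rightarrow> 'a set set" where
  "circuit_edges p = insert {last p, hd p} (set (path_edges p))"

definition circuit :: "'a set \<Rightarrow> 'a set set \<Rightarrow> 'a list \<Rightarrow> bool" where
  "circuit V E p \<longleftrightarrow> is_path V E p \<and> 3 \<le> length p \<and> {last p, hd p} \<in> E"

lemma cycles_eq: "cycles V E = circuit_edges ` {p. circuit V E p}"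
  by (auto simp: cycles_def circuit_def circuit_edges_def)

lemma circuit_iff:
  "circuit V E p \<longleftrightarrow> distinct p \<and> set p \<subseteq> V \<and> 3 \<le> length p \<and> circuit_edges p \<subseteq> E"
  by (auto simp: circuit_def is_path_def circuit_edges_def successively_edges_iff)

lemma nth_path_edges: "Suc i < length p \<Longrightarrow> path_edges p ! i = {p ! i, p ! Suc i}"
  by (simp add: path_edges_def nth_tl)

lemma set_path_edges: "set (path_edges p) = (\<lambda>i. {p ! i, p ! Suc i}) ` {i. Suc i < length p}"
proof -
  have "set (path_edges p) = (\<lambda>i. path_edges p ! i) ` {..<length p - 1}"
    by (auto simp: set_conv_nth)
  also have "\<dots> = (\<lambda>i. {p ! i, p ! Suc i}) ` {i. Suc i < length p}"
    by (rule image_cong) (auto simp: nth_path_edges)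
  finally show ?thesis .
qed

text \<open>From three vertices on, the closing edge differs from all path edges. This translates
  the circumference, measured on edge sets, into the length of a vertex list.\<close>

lemma card_circuit_edges:
  assumes "distinct p" "3 \<le> length p"
  shows "card (circuit_edges p) = length p"
proof -
  have "{last p, hd p} \<notin> set (path_edges p)"
  proof
    assume "{last p, hd p} \<in> set (path_edges p)"
    then obtain i where i: "Suc i < length p" "{last p, hd p} = {p ! i, p ! Suc i}"
      by (auto simp: set_path_edges)
    have "p \<noteq> []" using assms by auto
    then have "{p ! (length p - 1), p ! 0} = {p ! i, p ! Suc i}"
      using i by (simp add: last_conv_nth hd_conv_nth)
    moreover have "0 < length p" "length p - 1 < length p" using assms by auto
    \<comment> \<open>The first and the last position would have to be consecutive, which forces
      length two.\<close>
    ultimately have "(length p - 1 = i \<and> 0 = Suc i) \<or> (length p - 1 = Suc i \<and> 0 = i)"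
      using assms(1) i(1) by (auto simp: doubleton_eq_iff nth_eq_iff_index_eq)
    then show False using assms(2) by auto
  qed
  then show ?thesis
    using assms by (simp add: circuit_edges_def distinct_card distinct_path_edges)
qed

lemma circuit_edges_rotate1: "circuit_edges (rotate1 p) = circuit_edges p"
proof (cases p)
  case (Cons x q)
  show ?thesis
  proof (cases q)
    case (Cons y r)
    then show ?thesis
      using \<open>p = x # q\<close> path_edges_snoc[of q x] by (auto simp: circuit_edges_def)
  qed (simp add: Cons)
qed simp

lemma circuit_edges_rotate: "circuit_edges (rotate n p) = circuit_edges p"
  by (induction n) (auto simp: circuit_edges_rotate1)

text \<open>Lets a circuit start at the vertex where an additional edge is attached, which is how
  the certificates are numbered.\<close>

lemma circuit_rotate_to:
  assumes "distinct p" "v \<in> set p"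
  obtains q where "circuit_edges (v # q) = circuit_edges p" "set (v # q) = set p"
    "distinct (v # q)" "Suc (length q) = length p"
proof -
  obtain i where i: "i < length p" "p ! i = v" using assms(2) by (auto simp: in_set_conv_nth)
  let ?r = "rotate i p"
  have "p \<noteq> []" using i by auto
  then have "hd ?r = v" "?r \<noteq> []" using i by (auto simp: hd_rotate_conv_nth)
  then obtain q where r: "?r = v # q" by (cases ?r) auto
  show ?thesis
  proof (rule that[of q])
    show "circuit_edges (v # q) = circuit_edges p" using circuit_edges_rotate[of i p] r by simp
    show "set (v # q) = set p" using set_rotate[of i p] r by simp
    show "distinct (v # q)" using assms(1) distinct_rotate[of i p] r by simp
    show "Suc (length q) = length p" using length_rotate[of i p] r by simp
  qed
qed

lemma circuit_edges_nth:
  assumes "i < length p"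
  shows "{p ! i, p ! (Suc i mod length p)} \<in> circuit_edges p"
proof (cases "Suc i < length p")
  case True
  then show ?thesis by (auto simp: circuit_edges_def set_path_edges)
next
  case False
  then have "Suc i = length p" using assms by auto
  then have "i = length p - 1" "p \<noteq> []" by auto
  then show ?thesis by (simp add: circuit_edges_def last_conv_nth hd_conv_nth)
qed

lemma circuit_edges_subset: "p \<noteq> [] \<Longrightarrow> \<Union>(circuit_edges p) \<subseteq> set p"
  using path_edges_subset[of _ p] by (auto simp: circuit_edges_def)

lemma mod_eq_close:
  fixes a b l :: nat
  assumes "a mod l = b mod l" "a < b + l" "b < a + l"
  shows "a = b"
proof -
  have "a = b" if "a \<le> b" "a mod l = b mod l" "b < a + l" for a b :: nat
  proof -
    have "l dvd b - a" using that mod_eq_dvd_iff_nat[of a b l] by simp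
    then show ?thesis using that by (auto dest: dvd_imp_le)
  qed
  then show ?thesis using assms by (metis nat_le_linear)
qed

text \<open>The elements of the circuit, read cyclically as vertex, edge, vertex, \<dots>, receive the colors
  \<open>0, 1, 2, \<dots>\<close> modulo the length, so that any \<open>length vs\<close> consecutive ones are colored
  differently. The edge between the positions \<open>i\<close> and \<open>i + 1\<close> gets \<open>2 i + 1\<close>, the sum of its ends.\<close>

lemma colorable_circuit:
  fixes vs :: "'a list"
  assumes vs: "distinct vs" "3 \<le> length vs"
  shows "colorable (set vs) (circuit_edges vs) (length vs)"
proof -
  define l where "l = length vs"
  define g where "g = the_inv_into {..<length vs} ((!) vs)"
  \<comment> \<open>The sum over the ends ignores their order and also fits the closing edge:
    \<open>(l - 1) + 0\<close> and \<open>2 * (l - 1) + 1\<close> agree modulo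
    \<open>l\<close>.\<close>
  define c :: "'a + 'a set \<Rightarrow> nat" where
    "c x = (case x of Inl v \<Rightarrow> 2 * g v mod l | Inr e \<Rightarrow> (\<Sum>v\<in>e. g v) mod l)" for x
  \<comment> \<open>Positions are read modulo \<open>l\<close>, so that an arc may run past the end
    of the list.\<close>
  define w where "w t = vs ! (t mod l)" for t
  have l: "3 \<le> l" using vs by (simp add: l_def)
  have lt: "t mod l < length vs" for t using l by (simp add: l_def[symmetric])
  have w_in: "w t \<in> set vs" for t using lt by (simp add: w_def)
  have g: "g (w t) = t mod l" for t
    using the_inv_into_nth[OF vs(1) lt] by (simp add: g_def w_def)
  have w_inj: "t = t'" if "w t = w t'" "t < t' + l" "t' < t + l" for t t'
    using that g[of t] g[of t'] by (metis mod_eq_close)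
  have c_vertex: "c (Inl (w t)) = 2 * t mod l" for t
    by (simp add: c_def g mod_mult_right_eq)
  have c_edge: "c (Inr {w t, w (Suc t)}) = (2 * t + 1) mod l" for t
  proof -
    have "w t \<noteq> w (Suc t)" using w_inj[of t "Suc t"] l by auto
    then have "c (Inr {w t, w (Suc t)}) = (t mod l + Suc t mod l) mod l"
      by (simp add: c_def g)
    also have "\<dots> = (t + Suc t) mod l" by (simp add: mod_add_eq)
    finally show ?thesis by (simp add: mult_2)
  qed
  define arc where "arc i d = map w [i..<Suc (i + d)]" for i d
  \<comment> \<open>An arc with \<open>d\<close> edges has \<open>d - 1\<close> internal vertices;
    these \<open>2 * d - 1\<close> consecutive elements must not exceed the \<open>l\<close>
    colors.\<close>
  have arc: "path_between (set vs) (circuit_edges vs) (w i) (arc i d) (w (i + d)) \<and>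
      total_rainbow c (arc i d)" if d: "0 < d" "d < l" "2 * d \<le> l + 1" for i d
  proof -
    have nth: "arc i d ! k = w (i + k)" if "k \<le> d" for k
      using that by (simp add: arc_def del: upt_Suc)
    have len: "length (arc i d) = Suc d" by (simp add: arc_def)
    have ne: "arc i d \<noteq> []" using len by auto
    have edges: "set (path_edges (arc i d)) = (\<lambda>t. {w t, w (Suc t)}) ` {i..<i + d}"
    proof -
      have "set (path_edges (arc i d)) = (\<lambda>k. {w (i + k), w (Suc (i + k))}) ` {..<d}"
        by (auto simp: set_path_edges len nth)
      also have "\<dots> = (\<lambda>t. {w t, w (Suc t)}) ` ((+) i ` {0..<d})"
        by (simp only: image_image lessThan_atLeast0 add_Suc_right)
      also have "(+) i ` {0..<d} = {i..<i + d}" by (simp add: add.commute)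
      finally show ?thesis .
    qed
    have dist: "distinct (arc i d)"
      unfolding arc_def distinct_map using d w_inj by (auto simp: inj_on_def)
    have ends: "hd (arc i d) = w i" "last (arc i d) = w (i + d)"
      using nth[of 0] nth[of d] ne len by (simp_all add: hd_conv_nth last_conv_nth)
    have "[i..<Suc (i + d)] = i # [Suc i..<i + d] @ [i + d]"
      using d(1) by (simp add: upt_conv_Cons)
    then have int: "set (internal_vertices (arc i d)) = w ` {Suc i..<i + d}"
      by (simp add: internal_vertices_def arc_def butlast_append del: upt_Suc)
    have "{w t, w (Suc t)} \<in> circuit_edges vs" for t
      using circuit_edges_nth[OF lt, of t, folded l_def] by (simp add: w_def mod_Suc_eq)
    then have "path_between (set vs) (circuit_edges vs) (w i) (arc i d) (w (i + d))"
      using dist edges ends ne w_in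
      by (auto simp: path_between_def is_path_def successively_edges_iff arc_def simp del: upt_Suc)
    moreover have "inj_on c (Inl ` w ` {Suc i..<i + d} \<union> Inr ` (\<lambda>t. {w t, w (Suc t)}) ` {i..<i + d})"
    proof -
      \<comment> \<open>Before reduction the colors on the arc lie between \<open>2 * i + 1\<close>
        and \<open>2 * (i + d) - 1\<close>, less than \<open>l\<close> apart. Equal residues
        therefore mean equal numbers, and parity separates vertices from edges.\<close>
      have odd_even: "2 * t mod l \<noteq> (2 * s + 1) mod l"
        if "Suc i \<le> t" "t < i + d" "i \<le> s" "s < i + d" for s t
      proof
        assume "2 * t mod l = (2 * s + 1) mod l"
        then have "2 * t = 2 * s + 1" by (rule mod_eq_close) (use that d in linarith)+
        then show False by presburger
      qed
      have even: "t = s" if "2 * t mod l = 2 * s mod l" "Suc i \<le> t" "t < i + d" "Suc i \<le> s" "s < i + d" for s t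
      proof -
        have "2 * t = 2 * s" by (rule mod_eq_close[OF that(1)]) (use that d in linarith)+
        then show ?thesis by simp
      qed
      have odd: "t = s" if "(2 * t + 1) mod l = (2 * s + 1) mod l" "i \<le> t" "t < i + d" "i \<le> s" "s < i + d" for s t
      proof -
        have "2 * t + 1 = 2 * s + 1" by (rule mod_eq_close[OF that(1)]) (use that d in linarith)+
        then show ?thesis by simp
      qed
      show ?thesis
      proof (rule inj_onI)
        fix x y
        assume "x \<in> Inl ` w ` {Suc i..<i + d} \<union> Inr ` (\<lambda>t. {w t, w (Suc t)}) ` {i..<i + d}"
          and "y \<in> Inl ` w ` {Suc i..<i + d} \<union> Inr ` (\<lambda>t. {w t, w (Suc t)}) ` {i..<i + d}"
          and xy: "c x = c y"
        then consider
            t s where "x = Inl (w t)" "y = Inl (w s)" "t \<in> {Suc i..<i + d}" "s \<in> {Suc i..<i + d}"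
          | t s where "x = Inl (w t)" "y = Inr {w s, w (Suc s)}" "t \<in> {Suc i..<i + d}" "s \<in> {i..<i + d}"
          | t s where "x = Inr {w t, w (Suc t)}" "y = Inl (w s)" "t \<in> {i..<i + d}" "s \<in> {Suc i..<i + d}"
          | t s where "x = Inr {w t, w (Suc t)}" "y = Inr {w s, w (Suc s)}" "t \<in> {i..<i + d}" "s \<in> {i..<i + d}"
          by blast
        then show "x = y"
        proof cases
          case (1 t s)
          then have "2 * t mod l = 2 * s mod l" using xy c_vertex by simp
          then show ?thesis using even[of t s] 1 by simp
        next
          case (2 t s)
          then have "2 * t mod l = (2 * s + 1) mod l" using xy c_vertex c_edge by metis
          then show ?thesis using odd_even[of t s] 2 by simp
        next
          case (3 t s)
          then have "2 * s mod l = (2 * t + 1) mod l" using xy c_vertex c_edge by metis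
          then show ?thesis using odd_even[of s t] 3 by simp
        next
          case (4 t s)
          then have "(2 * t + 1) mod l = (2 * s + 1) mod l" using xy c_edge by metis
          then show ?thesis using odd[of t s] 4 by simp
        qed
      qed
    qed
    ultimately show ?thesis by (simp add: total_rainbow_def int edges)
  qed
  have half: "\<exists>p. path_between (set vs) (circuit_edges vs) (w i) p (w j) \<and> total_rainbow c p"
    if ij: "i < j" "j < l" for i j
  proof (cases "2 * (j - i) \<le> l + 1")
    case True
    then show ?thesis using arc[of "j - i" i] ij by auto
  next
    case False
    \<comment> \<open>When the arc from \<open>i\<close> to \<open>j\<close> is too long, the
      complementary one from \<open>j\<close> onward is short enough.\<close>
    have "w (j + (l - (j - i))) = w i"
    proof -
      have "j + (l - (j - i)) = i + l" using ij by simp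
      then show ?thesis by (simp add: w_def)
    qed
    then have "path_between (set vs) (circuit_edges vs) (w j) (arc j (l - (j - i))) (w i) \<and>
        total_rainbow c (arc j (l - (j - i)))"
      using arc[of "l - (j - i)" j] ij False by auto
    then show ?thesis
      by (intro exI[of _ "rev (arc j (l - (j - i)))"]) (simp add: path_between_rev total_rainbow_rev)
  qed
  have "\<exists>p. path_between (set vs) (circuit_edges vs) u p v \<and> total_rainbow c p"
    if uv: "u \<in> set vs" "v \<in> set vs" "u \<noteq> v" for u v
  proof -
    obtain i j where ij: "u = w i" "v = w j" "i < l" "j < l"
      using uv by (auto simp: in_set_conv_nth w_def l_def)
    then consider "i < j" | "j < i" using uv by fastforce
    then show ?thesis
    proof cases
      case 1
      then show ?thesis using half[of i j] ij by simp
    next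
      case 2
      then obtain p where "path_between (set vs) (circuit_edges vs) v p u" "total_rainbow c p"
        using half[of j i] ij by auto
      then show ?thesis by (intro exI[of _ "rev p"] conjI path_between_rev total_rainbow_rev)
    qed
  qed
  then have "total_rainbow_connected (set vs) (circuit_edges vs) c"
    by (simp add: total_rainbow_connected_def)
  moreover have "c x < l" for x using l by (cases x) (auto simp: c_def)
  ultimately show ?thesis unfolding colorable_def l_def by blast
qed

section \<open>Good subgraphs\<close>

lemma colorable_le: "colorable V E k \<Longrightarrow> k \<le> k' \<Longrightarrow> colorable V E k'"
  unfolding colorable_def by (meson lessThan_subset_iff subset_trans)

lemma length7E:
  assumes "length p = 7" obtains a b c d e f g where "p = [a, b, c, d, e, f, g]"
  using assms by (auto simp: numeral_eq_Suc length_Suc_conv)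

lemma length8E:
  assumes "length p = 8" obtains a b c d e f g h where "p = [a, b, c, d, e, f, g, h]"
  using assms by (auto simp: numeral_eq_Suc length_Suc_conv)

lemma length6E:
  assumes "length p = 6" obtains a b c d e f where "p = [a, b, c, d, e, f]"
  using assms by (auto simp: numeral_eq_Suc length_Suc_conv)

locale connected_simple_graph =
  fixes V :: "'a set" and E :: "'a set set"
  assumes simple: "simple_graph V E" and conn: "connected_graph V E"
begin

lemma finite_V: "finite V"
  using simple by (simp add: simple_graph_def)

lemma edge_ends: "{a, b} \<in> E \<Longrightarrow> a \<in> V \<and> b \<in> V \<and> a \<noteq> b"
  using simple by (fastforce simp: simple_graph_def)

lemmas goodI = good_certificate[OF simple conn]

lemma circuit_hexagon:
  "circuit V E [a, b, c, d, e, f] \<longleftrightarrow> distinct [a, b, c, d, e, f] \<and> {a, b, c, d, e, f} \<subseteq> V \<and>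
     {{a, b}, {b, c}, {c, d}, {d, e}, {e, f}, {f, a}} \<subseteq> E"
  by (auto simp: circuit_iff circuit_edges_def)

lemma hexagon_rotate: "circuit V E [a, b, c, d, e, f] \<Longrightarrow> circuit V E [b, c, d, e, f, a]"
  by (auto simp: circuit_hexagon)

lemma hexagon_reflect: "circuit V E [a, b, c, d, e, f] \<Longrightarrow> circuit V E [a, f, e, d, c, b]"
  by (auto simp: circuit_hexagon insert_commute)

text \<open>The periodic coloring suffices from length \<open>9\<close> on, where
  \<open>length p \<le> 2 * length p - 9\<close>, and uses one color too many at length
  \<open>8\<close>. At length \<open>7\<close> the bound on \<open>card V\<close> provides a vertex
  outside the circuit and hence a pendant edge.\<close>

lemma long_circuit_good:
  assumes p: "circuit V E p" "7 \<le> length p" and card: "8 \<le> card V"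
  shows "good V E"
proof -
  have p': "distinct p" "set p \<subseteq> V" "circuit_edges p \<subseteq> E" "p \<noteq> []"
    using p by (auto simp: circuit_iff)
  have len: "length p \<le> card V"
    using p' finite_V by (metis card_mono distinct_card)
  consider "9 \<le> length p" | "length p = 8" | "length p = 7" using p(2) by linarith
  then show ?thesis
  proof cases
    case 1
    have "colorable V E (length p + 2 * (card V - card (set p)))"
      using p' 1 by (intro colorable_supergraph[OF simple conn colorable_circuit] circuit_edges_subset) auto
    then show ?thesis
      unfolding good_def by (rule colorable_le) (use 1 len p' in \<open>simp add: distinct_card\<close>)
  next
    case 2
    then obtain a b c d e f g h where "p = [a, b, c, d, e, f, g, h]" by (rule length8E)
    then show ?thesis
      using p' by (intro goodI[OF _ _ _ _ certificate_C8, of p])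
        (auto simp: list_edges_def circuit_edges_def insert_commute)
  next
    case 3
    then have "card (set p) \<noteq> card V" using p' card by (simp add: distinct_card)
    then have "set p \<noteq> V" by auto
    then obtain v w where vw: "v \<in> set p" "w \<in> V - set p" "{v, w} \<in> E"
      using connected_boundary_edge[OF conn p'(2)] p'(4) by auto
    obtain q where q: "circuit_edges (v # q) = circuit_edges p" "set (v # q) = set p"
        "distinct (v # q)" "Suc (length q) = length p"
      using circuit_rotate_to[OF p'(1) vw(1)] by metis
    have "length (v # q) = 7" using q(4) 3 by simp
    then obtain a b c d e f g where eq: "v # q = [a, b, c, d, e, f, g]" by (rule length7E)
    then have "v = a" by simp
    moreover note q(2,3)[unfolded eq]
    moreover have "circuit_edges [a, b, c, d, e, f, g] \<subseteq> E" using p'(3) q(1)[unfolded eq] by simp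
    ultimately show ?thesis
      using vw p'(2) by (intro goodI[OF _ _ _ _ certificate_C7_pendant, of "[a, b, c, d, e, f, g, w]"])
        (auto simp: list_edges_def circuit_edges_def insert_commute)
  qed
qed

text \<open>Up to reflection at \<open>a\<close>, a chord spans two or three edges of the
  heptagon.\<close>

lemma heptagon_chord_good:
  assumes p: "circuit V E [a, b, c, d, e, f, g]" and ch: "{a, y} \<in> E" "y \<in> {c, d, e, f}"
  shows "good V E"
proof -
  have p': "distinct [a, b, c, d, e, f, g]" "{a, b, c, d, e, f, g} \<subseteq> V"
    "{{a, b}, {b, c}, {c, d}, {d, e}, {e, f}, {f, g}, {g, a}} \<subseteq> E"
    using p by (auto simp: circuit_iff circuit_edges_def)
  consider "y = c" | "y = d" | "y = e" | "y = f" using ch(2) by auto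
  then show ?thesis
  proof cases
    case 1
    then show ?thesis
      using p' ch by (intro goodI[OF _ _ _ _ certificate_C7_chord2, of "[a, b, c, d, e, f, g]"])
        (auto simp: list_edges_def insert_commute)
  next
    case 2
    then show ?thesis
      using p' ch by (intro goodI[OF _ _ _ _ certificate_C7_chord3, of "[a, b, c, d, e, f, g]"])
        (auto simp: list_edges_def insert_commute)
  next
    case 3
    then show ?thesis
      using p' ch by (intro goodI[OF _ _ _ _ certificate_C7_chord3, of "[a, g, f, e, d, c, b]"])
        (auto simp: list_edges_def insert_commute)
  next
    case 4
    then show ?thesis
      using p' ch by (intro goodI[OF _ _ _ _ certificate_C7_chord2, of "[a, g, f, e, d, c, b]"])
        (auto simp: list_edges_def insert_commute)
  qed
qed

text \<open>The circuit spans \<open>V\<close>. If it had no chord, every circuit would have the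
  same edge set, against the existence of two cycles.\<close>

lemma heptagon_good:
  assumes p: "circuit V E p" "length p = 7" and V: "card V = 7" and cyc: "2 \<le> card (cycles V E)"
  shows "good V E"
proof -
  have p': "distinct p" "set p \<subseteq> V" "circuit_edges p \<subseteq> E" using p by (auto simp: circuit_iff)
  have set_p: "set p = V"
    using p' p(2) V finite_V by (metis card_subset_eq distinct_card)
  have rot: "\<exists>b c d e f g. distinct [a, b, c, d, e, f, g] \<and> set [a, b, c, d, e, f, g] = V \<and>
      circuit_edges [a, b, c, d, e, f, g] = circuit_edges p" if a: "a \<in> V" for a
  proof -
    obtain q where q: "circuit_edges (a # q) = circuit_edges p" "set (a # q) = set p"
        "distinct (a # q)" "Suc (length q) = length p"
      using circuit_rotate_to[OF p'(1), of a] a set_p by metis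
    have "length (a # q) = 7" using q(4) p(2) by simp
    then obtain b c d e f g where "a # q = [a, b, c, d, e, f, g]" by (metis length7E list.inject)
    then show ?thesis using q set_p by metis
  qed
  have "circuit_edges p \<noteq> E"
  proof
    assume E: "circuit_edges p = E"
    have "circuit_edges q = E" if q: "circuit V E q" for q
    proof -
      have q': "distinct q" "set q \<subseteq> V" "3 \<le> length q" "circuit_edges q \<subseteq> E"
        using q by (auto simp: circuit_iff)
      \<comment> \<open>A circuit missing a vertex would contain some \<open>a\<close> with a
        neighbor outside it and two neighbors on it, whereas without chords every vertex has only
        two neighbors.\<close>
      have "set q = V"
      proof (rule ccontr)
        assume "set q \<noteq> V"
        moreover have "set q \<noteq> {}" using q'(3) by auto
        ultimately obtain a y where ay: "a \<in> set q" "y \<in> V - set q" "{a, y} \<in> E"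
          using connected_boundary_edge[OF conn q'(2)] by auto
        obtain r where r: "circuit_edges (a # r) = circuit_edges q" "set (a # r) = set q"
            "distinct (a # r)" "Suc (length r) = length q"
          using circuit_rotate_to[OF q'(1) ay(1)] by metis
        obtain b r' where r': "r = b # r'" "r' \<noteq> []"
          using r(4) q'(3) by (cases r; cases "tl r") auto
        have "circuit_edges (a # r) \<subseteq> E" using r(1) q'(4) by simp
        then have nbrs: "{a, b} \<in> E" "{a, last r'} \<in> E"
          using r' by (simp_all add: circuit_edges_def insert_commute)
        have "last r' \<in> set r'" using r'(2) by simp
        then have nbrs': "b \<noteq> last r'" "b \<noteq> y" "last r' \<noteq> y"
          using r(2,3) r'(1) ay(2) by auto
        have "a \<in> V" using ay(1) q'(2) by auto
        then obtain b1 c1 d1 e1 f1 g1 where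
          h: "distinct [a, b1, c1, d1, e1, f1, g1]" "circuit_edges [a, b1, c1, d1, e1, f1, g1] = E"
          using rot[of a] E by metis
        have "x = b1 \<or> x = g1" if x: "{a, x} \<in> E" for x
        proof -
          have "{a, x} \<in> circuit_edges [a, b1, c1, d1, e1, f1, g1]" using x h(2) by simp
          then show ?thesis using h(1) by (auto simp: circuit_edges_def doubleton_eq_iff)
        qed
        from this[OF nbrs(1)] this[OF nbrs(2)] this[OF ay(3)] show False using nbrs' by auto
      qed
      then have "length q = 7" using V q'(1) by (metis distinct_card)
      then have "card (circuit_edges q) = card E"
        using card_circuit_edges[OF q'(1,3)] card_circuit_edges[OF p'(1)] p(2) E by simp
      moreover have "finite E"
        using E p(2) card_circuit_edges[OF p'(1)] by (intro card_ge_0_finite) simp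
      ultimately show ?thesis using q'(4) by (simp add: card_subset_eq)
    qed
    then have "cycles V E \<subseteq> {E}" by (auto simp: cycles_eq)
    then have "card (cycles V E) \<le> 1" using card_mono[of "{E}"] by simp
    then show False using cyc by simp
  qed
  then obtain ed where ed: "ed \<in> E" "ed \<notin> circuit_edges p" using p' by auto
  then obtain a y where ay: "ed = {a, y}" "a \<noteq> y" "a \<in> V" "y \<in> V"
    using simple by (auto simp: simple_graph_def card_2_iff)
  obtain b c d e f g where h: "distinct [a, b, c, d, e, f, g]" "set [a, b, c, d, e, f, g] = V"
      "circuit_edges [a, b, c, d, e, f, g] = circuit_edges p"
    using rot[OF ay(3)] by blast
  have "{a, b} \<in> circuit_edges [a, b, c, d, e, f, g]" "{a, g} \<in> circuit_edges [a, b, c, d, e, f, g]"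
    by (simp_all add: circuit_edges_def insert_commute)
  then have "y \<noteq> b" "y \<noteq> g" using ed(2) ay(1) h(3) by auto
  moreover have "y \<in> {a, b, c, d, e, f, g}" using ay(4) h(2) by simp
  ultimately have y: "y \<in> {c, d, e, f}" using ay(2) by simp
  have "circuit_edges [a, b, c, d, e, f, g] \<subseteq> E" using h(3) p'(3) by simp
  then have "circuit V E [a, b, c, d, e, f, g]" using h(1,2) by (simp add: circuit_iff)
  then show ?thesis by (rule heptagon_chord_good) (use ed(1) ay(1) y in auto)
qed

section \<open>Good configurations on a hexagon\<close>

lemma hexagon_ear_good:
  assumes h: "circuit V E [a, b, c, d, e, f]" and x: "x \<notin> {a, b, c, d, e, f}"
    and ax: "{a, x} \<in> E" and xy: "{x, y} \<in> E" "y \<in> {b, c, d, e, f}"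
  shows "good V E"
proof -
  \<comment> \<open>The second foot of the ear is one, two or three steps away from
    \<open>a\<close>; reflection at \<open>a\<close> covers the other side.\<close>
  have half: "good V E"
    if h: "circuit V E [a, b, c, d, e, f]" and x: "x \<notin> {a, b, c, d, e, f}"
      and ax: "{a, x} \<in> E" and xy: "{x, y} \<in> E" "y \<in> {b, c, d}" for a b c d e f y
  proof -
    note h' = h[unfolded circuit_hexagon]
    have "x \<in> V" using edge_ends ax by blast
    consider "y = b" | "y = c" | "y = d" using xy(2) by auto
    then show ?thesis
    proof cases
      case 1
      then show ?thesis
        using h' x ax xy \<open>x \<in> V\<close>
        by (intro goodI[OF _ _ _ _ certificate_C6_ear1, of "[a, b, c, d, e, f, x]"])
          (auto simp: list_edges_def insert_commute)
    next
      case 2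
      then show ?thesis
        using h' x ax xy \<open>x \<in> V\<close>
        by (intro goodI[OF _ _ _ _ certificate_C6_ear2, of "[a, b, c, d, e, f, x]"])
          (auto simp: list_edges_def insert_commute)
    next
      case 3
      then show ?thesis
        using h' x ax xy \<open>x \<in> V\<close>
        by (intro goodI[OF _ _ _ _ certificate_C6_ear3, of "[a, b, c, d, e, f, x]"])
          (auto simp: list_edges_def insert_commute)
    qed
  qed
  show ?thesis
  proof (cases "y \<in> {b, c, d}")
    case True
    then show ?thesis using half[OF h x ax xy(1)] by simp
  next
    case False
    then show ?thesis
      by (intro half[OF hexagon_reflect[OF h] _ ax xy(1)]) (use x xy(2) in auto)
  qed
qed

text \<open>The ear completes three paths of length three between \<open>a\<close> and
  \<open>d\<close>. All cycles of this theta graph are hexagons, so a bound on longer circuits does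
  not dispose of it.\<close>

lemma hexagon_long_ear_good:
  assumes h: "circuit V E [a, b, c, d, e, f]"
    and x: "x \<notin> {a, b, c, d, e, f}" "y \<notin> {a, b, c, d, e, f}"
    and xy: "{a, x} \<in> E" "{x, y} \<in> E" "{d, y} \<in> E"
  shows "good V E"
proof -
  have "x \<in> V" "y \<in> V" "x \<noteq> y" using edge_ends xy by blast+
  then show ?thesis
    using h[unfolded circuit_hexagon] x xy
    by (intro goodI[OF _ _ _ _ certificate_C6_long_ear, of "[a, b, c, d, e, f, x, y]"])
      (auto simp: list_edges_def insert_commute)
qed

text \<open>The listed chords are those that join vertices whose distances from \<open>a\<close>
  along the hexagon differ by more than one, that is, the chords that bring \<open>d\<close> closer
  to \<open>a\<close>.\<close>

lemma hexagon_pendant_chord_good: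
  assumes h: "circuit V E [a, b, c, d, e, f]" and x: "x \<notin> {a, b, c, d, e, f}"
    and ax: "{a, x} \<in> E"
    and ch: "{a, c} \<in> E \<or> {a, d} \<in> E \<or> {a, e} \<in> E \<or> {b, d} \<in> E \<or> {d, f} \<in> E"
  shows "good V E"
proof -
  note h' = h[unfolded circuit_hexagon]
  have xV: "x \<in> V" using edge_ends ax by blast
  consider "{a, c} \<in> E" | "{a, d} \<in> E" | "{a, e} \<in> E" | "{b, d} \<in> E" | "{d, f} \<in> E" using ch by blast
  then show ?thesis
  proof cases
    case 1
    then show ?thesis
      using h' x ax xV
      by (intro goodI[OF _ _ _ _ certificate_C6_pendant_chord02, of "[a, b, c, d, e, f, x]"])
        (auto simp: list_edges_def insert_commute)
  next
    case 2
    then show ?thesis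
      using h' x ax xV
      by (intro goodI[OF _ _ _ _ certificate_C6_pendant_chord03, of "[a, b, c, d, e, f, x]"])
        (auto simp: list_edges_def insert_commute)
  next
    case 3
    then show ?thesis
      using h' x ax xV
      by (intro goodI[OF _ _ _ _ certificate_C6_pendant_chord02, of "[a, f, e, d, c, b, x]"])
        (auto simp: list_edges_def insert_commute)
  next
    case 4
    then show ?thesis
      using h' x ax xV
      by (intro goodI[OF _ _ _ _ certificate_C6_pendant_chord13, of "[a, b, c, d, e, f, x]"])
        (auto simp: list_edges_def insert_commute)
  next
    case 5
    then show ?thesis
      using h' x ax xV
      by (intro goodI[OF _ _ _ _ certificate_C6_pendant_chord13, of "[a, f, e, d, c, b, x]"])
        (auto simp: list_edges_def insert_commute)
  qed
qed

text \<open>Covers attachment vertices one or two steps apart. Two pendant edges at the same vertex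
  are a matter of branching, and opposite vertices occur in the extremal graphs.\<close>

lemma hexagon_pendants_good:
  assumes h: "circuit V E [a, b, c, d, e, f]"
    and x: "x \<notin> {a, b, c, d, e, f}" "x' \<notin> {a, b, c, d, e, f}" "x \<noteq> x'"
    and ax: "{a, x} \<in> E" and yx: "{y, x'} \<in> E" "y \<in> {b, c, e, f}"
  shows "good V E"
proof -
  note h' = h[unfolded circuit_hexagon]
  have xV: "x \<in> V" "x' \<in> V" using edge_ends ax yx by blast+
  consider "y = b" | "y = c" | "y = e" | "y = f" using yx(2) by auto
  then show ?thesis
  proof cases
    case 1
    then show ?thesis
      using h' x ax xV yx
      by (intro goodI[OF _ _ _ _ certificate_C6_pendants1, of "[a, b, c, d, e, f, x, x']"])
        (auto simp: list_edges_def insert_commute)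
  next
    case 2
    then show ?thesis
      using h' x ax xV yx
      by (intro goodI[OF _ _ _ _ certificate_C6_pendants2, of "[a, b, c, d, e, f, x, x']"])
        (auto simp: list_edges_def insert_commute)
  next
    case 3
    then show ?thesis
      using h' x ax xV yx
      by (intro goodI[OF _ _ _ _ certificate_C6_pendants2, of "[a, f, e, d, c, b, x, x']"])
        (auto simp: list_edges_def insert_commute)
  next
    case 4
    then show ?thesis
      using h' x ax xV yx
      by (intro goodI[OF _ _ _ _ certificate_C6_pendants1, of "[a, f, e, d, c, b, x, x']"])
        (auto simp: list_edges_def insert_commute)
  qed
qed

text \<open>The chord \<open>{a, c}\<close> does not bring \<open>b\<close> and \<open>e\<close>
  closer together; the alternatives in \<open>ch\<close> are exactly the chords that do.\<close>

lemma hexagon_two_chords_good: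
  assumes h: "circuit V E [a, b, c, d, e, f]" and ac: "{a, c} \<in> E"
    and ch: "{b, e} \<in> E \<or> {b, d} \<in> E \<or> {b, f} \<in> E \<or> {a, e} \<in> E \<or> {c, e} \<in> E"
  shows "good V E"
proof -
  note h' = h[unfolded circuit_hexagon]
  consider "{b, e} \<in> E" | "{b, d} \<in> E" | "{b, f} \<in> E" | "{a, e} \<in> E" | "{c, e} \<in> E" using ch by blast
  then show ?thesis
  proof cases
    case 1
    then show ?thesis
      using h' ac
      by (intro goodI[OF _ _ _ _ certificate_C6_chords_02_14, of "[a, b, c, d, e, f]"])
        (auto simp: list_edges_def insert_commute)
  next
    case 2
    then show ?thesis
      using h' ac
      by (intro goodI[OF _ _ _ _ certificate_C6_chords_02_13, of "[a, b, c, d, e, f]"])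
        (auto simp: list_edges_def insert_commute)
  next
    case 3
    then show ?thesis
      using h' ac
      by (intro goodI[OF _ _ _ _ certificate_C6_chords_02_13, of "[c, b, a, f, e, d]"])
        (auto simp: list_edges_def insert_commute)
  next
    case 4
    then show ?thesis
      using h' ac
      by (intro goodI[OF _ _ _ _ certificate_C6_chords_02_24, of "[c, b, a, f, e, d]"])
        (auto simp: list_edges_def insert_commute)
  next
    case 5
    then show ?thesis
      using h' ac
      by (intro goodI[OF _ _ _ _ certificate_C6_chords_02_24, of "[a, b, c, d, e, f]"])
        (auto simp: list_edges_def insert_commute)
  qed
qed

lemma hexagon_long_chords_good:
  assumes h: "circuit V E [a, b, c, d, e, f]" and ch: "{a, d} \<in> E" "{b, e} \<in> E" "{c, f} \<in> E"
  shows "good V E"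
  using h[unfolded circuit_hexagon] ch
  by (intro goodI[OF _ _ _ _ certificate_K33, of "[a, b, c, d, e, f]"])
    (auto simp: list_edges_def insert_commute)

section \<open>Growing two tails from a hexagon\<close>

text \<open>The constant \<open>5\<close> becomes \<open>9\<close> once two pendant vertices are
  added for no color. The colored part \<open>B\<close> may be smaller than \<open>A\<close>: at the
  end of one tail it need not contain the other tail.\<close>

definition branch_point :: "'a set \<Rightarrow> 'a \<Rightarrow> bool" where
  "branch_point A u \<longleftrightarrow> (\<exists>B F k. B \<subseteq> A \<and> u \<in> B \<and> F \<subseteq> E \<and> \<Union>F \<subseteq> B \<and>
     branchable B F u k \<and> k + 5 = 2 * card B)"

lemma branch_point_mono: "branch_point A u \<Longrightarrow> A \<subseteq> A' \<Longrightarrow> branch_point A' u"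
  unfolding branch_point_def by (meson subset_trans)

lemma branch_point_extend:
  assumes u: "branch_point A u" and A: "A \<subseteq> V" and w: "w \<notin> A" "{u, w} \<in> E"
  shows "branch_point (insert w A) w"
proof -
  obtain B F k where B: "B \<subseteq> A" "u \<in> B" "F \<subseteq> E" "\<Union>F \<subseteq> B" "branchable B F u k" "k + 5 = 2 * card B"
    using u unfolding branch_point_def by metis
  have wB: "w \<notin> B" "finite B" using B(1) A w(1) finite_V by (auto intro: finite_subset)
  have "branchable (insert w B) (insert {u, w} F) w (k + 2)"
    using B wB by (intro branchable_extend) auto
  moreover have "k + 2 + 5 = 2 * card (insert w B)" using B(6) wB by simp
  ultimately show ?thesis
    unfolding branch_point_def using B w
    by (intro exI[of _ "insert w B"] exI[of _ "insert {u, w} F"] exI[of _ "k + 2"]) auto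
qed

lemma branch_point_good:
  assumes u: "branch_point A u" and A: "A \<subseteq> V"
    and w: "w \<notin> A" "w' \<notin> A" "w \<noteq> w'" "{u, w} \<in> E" "{u, w'} \<in> E"
  shows "good V E"
proof -
  obtain B F k where B: "B \<subseteq> A" "u \<in> B" "F \<subseteq> E" "\<Union>F \<subseteq> B" "branchable B F u k" "k + 5 = 2 * card B"
    using u unfolding branch_point_def by metis
  have wB: "w \<notin> B" "w' \<notin> B" "finite B" using B(1) A w(1,2) finite_V by (auto intro: finite_subset)
  let ?B = "insert w (insert w' B)" and ?F = "insert {u, w} (insert {u, w'} F)"
  have sub: "?B \<subseteq> V" using B(1) A edge_ends[OF w(4)] edge_ends[OF w(5)] by auto
  have card: "card ?B = card B + 2" using wB w(3) by simp
  have le: "card ?B \<le> card V" using sub finite_V by (rule card_mono[rotated])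
  \<comment> \<open>The palette contains the spare colors, so it is not empty.\<close>
  have "0 < k"
    using B(5) unfolding branchable_def by (metis gr0I not_less_zero)
  moreover have "colorable ?B ?F k" using B wB w(3) by (intro branchable_pendants) auto
  ultimately have "colorable V E (k + 2 * (card V - card ?B))"
    using sub B w by (intro colorable_supergraph[OF simple conn, of ?B ?F]) auto
  moreover have "k + 2 * (card V - card ?B) = 2 * card V - 9" using card le B(6) by linarith
  ultimately show ?thesis unfolding good_def by metis
qed

lemma branch_point_hexagon:
  assumes h: "circuit V E [a, b, c, d, e, f]"
  shows "branch_point {a, b, c, d, e, f} a"
proof -
  note h' = h[unfolded circuit_hexagon]
  let ?vs = "[a, b, c, d, e, f]"
  let ?F = "{{a, b}, {a, f}, {b, c}, {c, d}, {d, e}, {e, f}}"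
  have "branchable (set ?vs) ?F (hd ?vs) 7"
    using branchable_certificate[OF _ _ _ branch_certificate_C6, of ?vs] h'
    by (simp add: list_edges_def)
  moreover have "card (set ?vs) = 6" using h' by (subst distinct_card) auto
  ultimately show ?thesis
    unfolding branch_point_def using h'
    by (intro exI[of _ "set ?vs"] exI[of _ ?F] exI[of _ 7]) (auto simp: insert_commute)
qed

text \<open>The set \<open>A\<close> consists of a hexagon with a tail at one vertex and possibly a second tail at the
  opposite vertex; \<open>lo\<close> and \<open>hi\<close> are the two extreme vertices. The function \<open>\<phi>\<close>, which changes by
  at most \<open>1\<close> along an edge, certifies that they are at distance \<open>card A - 3\<close>.\<close>

definition tails :: "'a set \<Rightarrow> 'a \<Rightarrow> 'a \<Rightarrow> ('a \<Rightarrow> int) \<Rightarrow> bool" where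
  "tails A lo hi \<phi> \<longleftrightarrow> A \<subseteq> V \<and> 7 \<le> card A \<and> lo \<in> A \<and> hi \<in> A \<and>
     (\<forall>a\<in>A. \<forall>b\<in>A. {a, b} \<in> E \<longrightarrow> \<bar>\<phi> a - \<phi> b\<bar> \<le> 1) \<and>
     \<phi> hi - \<phi> lo = int (card A) - 3 \<and>
     (\<forall>a\<in>A - {lo, hi}. \<forall>z\<in>V - A. {a, z} \<notin> E) \<and>
     (\<forall>z\<in>V - A. \<not> ({lo, z} \<in> E \<and> {hi, z} \<in> E)) \<and>
     branch_point A lo \<and> branch_point A hi \<and>
     (\<exists>p. path_between A E lo p hi \<and> length p + 2 = card A)"

text \<open>By this symmetry only growth at \<open>lo\<close> has to be treated.\<close>

lemma tails_swap:
  assumes "tails A lo hi \<phi>"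
  shows "tails A hi lo (\<lambda>x. - \<phi> x)"
proof -
  obtain p where p: "path_between A E lo p hi" "length p + 2 = card A"
    using assms unfolding tails_def by blast
  have "path_between A E hi (rev p) lo" "length (rev p) + 2 = card A"
    using p by (auto intro: path_between_rev)
  then have "\<exists>p. path_between A E hi p lo \<and> length p + 2 = card A" by blast
  moreover have "\<forall>z\<in>V - A. \<not> ({hi, z} \<in> E \<and> {lo, z} \<in> E)"
    using assms unfolding tails_def by blast
  ultimately show ?thesis
    using assms unfolding tails_def insert_commute[of hi lo "{}"] by (simp add: abs_minus_commute)
qed

text \<open>Inside \<open>A\<close>, the new vertex is adjacent to \<open>lo\<close> alone, so
  giving it the next smaller value keeps the slope condition and widens the gap by one. The
  conditions on outside neighbors persist because a violation would make the graph good.\<close>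

lemma tails_extend:
  assumes t: "tails A lo hi \<phi>" and bad: "\<not> good V E" and z: "z \<in> V - A" "{lo, z} \<in> E"
  shows "tails (insert z A) z hi (\<phi>(z := \<phi> lo - 1))"
proof -
  let ?\<phi> = "\<phi>(z := \<phi> lo - 1)" and ?A = "insert z A"
  have A: "A \<subseteq> V" "7 \<le> card A" "lo \<in> A" "hi \<in> A"
    and lip: "\<forall>a\<in>A. \<forall>b\<in>A. {a, b} \<in> E \<longrightarrow> \<bar>\<phi> a - \<phi> b\<bar> \<le> 1"
    and gap: "\<phi> hi - \<phi> lo = int (card A) - 3"
    and inner: "\<forall>a\<in>A - {lo, hi}. \<forall>z\<in>V - A. {a, z} \<notin> E"
    and both: "\<forall>z\<in>V - A. \<not> ({lo, z} \<in> E \<and> {hi, z} \<in> E)"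
    and br: "branch_point A lo" "branch_point A hi"
    using t unfolding tails_def by blast+
  obtain p where p: "path_between A E lo p hi" "length p + 2 = card A"
    using t unfolding tails_def by blast
  note pd = path_betweenD[OF p(1)]
  have finA: "finite A" using A(1) finite_V by (rule finite_subset)
  have cardA: "card ?A = card A + 1" using z finA by simp
  have nbr: "a = lo" if "a \<in> A" "{a, z} \<in> E" for a
    using that inner both z by blast
  have p': "path_between ?A E z (z # p) hi"
  proof -
    have "path_edges (z # p) = {z, lo} # path_edges p" using pd(1,5) by (cases p) auto
    then show ?thesis
      using pd z by (auto simp: path_between_def is_path_def successively_edges_iff insert_commute)
  qed
  have lip': "\<bar>?\<phi> a - ?\<phi> b\<bar> \<le> 1" if ab: "a \<in> ?A" "b \<in> ?A" "{a, b} \<in> E" for a b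
  proof -
    consider "a \<in> A" "b \<in> A" | "a = z" "b = z" | "a = z" "b \<in> A" | "a \<in> A" "b = z" using ab by auto
    then show ?thesis
    proof cases
      case 1
      then have "a \<noteq> z" "b \<noteq> z" using z by auto
      then show ?thesis using 1 lip ab(3) by simp
    next
      case 3
      then have "b = lo" using nbr[of b] ab(3) by (simp add: insert_commute)
      then show ?thesis using 3 z A(3) by auto
    next
      case 4
      then have "a = lo" using nbr[of a] ab(3) by simp
      then show ?thesis using 4 z A(3) by auto
    qed simp
  qed
  \<comment> \<open>A second outside neighbor of the old end \<open>lo\<close> would be a branching
    there.\<close>
  have inner': "{a, y} \<notin> E" if ay: "a \<in> ?A - {z, hi}" "y \<in> V - ?A" for a y
  proof (cases "a = lo")
    case True
    then show ?thesis
      using branch_point_good[OF br(1) A(1), of z y] bad z ay by auto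
  next
    case False
    then show ?thesis using inner ay by auto
  qed
  \<comment> \<open>Such a \<open>y\<close> would close the path through \<open>z\<close> to a
    circuit of length \<open>card A\<close>, which is at least \<open>7\<close>: the path
    \<open>p\<close> misses just two vertices of \<open>A\<close>, and \<open>y\<close> and
    \<open>z\<close> make up for them.\<close>
  have both': "\<not> ({z, y} \<in> E \<and> {hi, y} \<in> E)" if y: "y \<in> V - ?A" for y
  proof
    assume E: "{z, y} \<in> E \<and> {hi, y} \<in> E"
    have "path_edges (y # z # p) = {y, z} # path_edges (z # p)" by simp
    moreover note path_betweenD[OF p']
    ultimately have "circuit V E (y # z # p)"
      using E y A(1) z pd(1,2,6) p(2) A(2)
      by (auto simp: circuit_iff circuit_edges_def insert_commute)
    moreover have "card (insert y ?A) = card A + 2" using y z finA by auto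
    then have "8 \<le> card V" using card_mono[OF finite_V, of "insert y ?A"] y z A by auto
    ultimately show False using long_circuit_good bad p(2) A(2) by fastforce
  qed
  have gap': "?\<phi> hi - ?\<phi> z = int (card ?A) - 3" using gap cardA z A(4) by auto
  have br': "branch_point ?A z" "branch_point ?A hi"
    using branch_point_extend[OF br(1) A(1), of z] branch_point_mono[OF br(2), of ?A] z by auto
  have path': "\<exists>p. path_between ?A E z p hi \<and> length p + 2 = card ?A"
    using p' p(2) cardA by (intro exI[of _ "z # p"]) simp
  show ?thesis
    unfolding tails_def using A z cardA lip' gap' inner' both' br' path' by (intro conjI ballI) auto
qed

section \<open>Lower bounds on the diameter from integer functions\<close>

lemma lipschitz_path:
  fixes \<phi> :: "'a \<Rightarrow> int"
  assumes "\<And>a b. {a, b} \<in> E \<Longrightarrow> \<bar>\<phi> a - \<phi> b\<bar> \<le> 1" "p \<noteq> []" "set (path_edges p) \<subseteq> E"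
  shows "\<phi> (last p) - \<phi> (hd p) \<le> int (length p) - 1"
  using assms(2,3)
proof (induction p rule: induct_list012)
  case (3 x y zs)
  then have "\<phi> (last (y # zs)) - \<phi> y \<le> int (length (y # zs)) - 1" by simp
  moreover have "\<bar>\<phi> x - \<phi> y\<bar> \<le> 1" using 3 assms(1) by simp
  ultimately show ?case by simp
qed auto

lemma lipschitz_diam:
  fixes \<phi> :: "'a \<Rightarrow> int"
  assumes lip: "\<And>a b. {a, b} \<in> E \<Longrightarrow> \<bar>\<phi> a - \<phi> b\<bar> \<le> 1" and uv: "u \<in> V" "v \<in> V"
  shows "\<phi> v - \<phi> u \<le> int (diam V E)"
proof -
  obtain q where "path_between V E u q v" using conn uv unfolding connected_graph_def by blast
  then have "\<exists>p. path_between V E u p v \<and> length (path_edges p) = graph_dist V E u v"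
    unfolding graph_dist_def
    by (intro LeastI[where k = "length (path_edges q)" and
          P = "\<lambda>k. \<exists>p. path_between V E u p v \<and> length (path_edges p) = k"]) blast
  then obtain p where p: "path_between V E u p v" "length p - 1 = graph_dist V E u v" by auto
  note pd = path_betweenD[OF p(1)]
  have "\<phi> v - \<phi> u \<le> int (length p) - 1"
    using lipschitz_path[of \<phi> p] lip pd by metis
  also have "\<dots> = int (graph_dist V E u v)" using p(2) pd(1) by (cases p) auto
  also have "\<dots> \<le> int (diam V E)" using graph_dist_le_diam[OF finite_V uv] by simp
  finally show ?thesis .
qed

text \<open>As long as \<open>A\<close> is not everything, some edge leaves it, necessarily at
  \<open>lo\<close> or \<open>hi\<close>, and the structure grows there. In the end
  \<open>\<phi>\<close> satisfies the slope condition on all of \<open>V\<close> and bounds the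
  diameter.\<close>

lemma tails_diam:
  assumes "tails A lo hi \<phi>" and bad: "\<not> good V E"
  shows "int (card V) - 3 \<le> int (diam V E)"
  using assms(1)
proof (induction "card V - card A" arbitrary: A lo hi \<phi> rule: less_induct)
  case less
  have A: "A \<subseteq> V" "lo \<in> A" "hi \<in> A"
    and lip: "\<forall>a\<in>A. \<forall>b\<in>A. {a, b} \<in> E \<longrightarrow> \<bar>\<phi> a - \<phi> b\<bar> \<le> 1"
    and gap: "\<phi> hi - \<phi> lo = int (card A) - 3"
    and inner: "\<forall>a\<in>A - {lo, hi}. \<forall>z\<in>V - A. {a, z} \<notin> E"
    using less.prems unfolding tails_def by blast+
  show ?case
  proof (cases "A = V")
    case True
    have "\<bar>\<phi> a - \<phi> b\<bar> \<le> 1" if "{a, b} \<in> E" for a b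
      using edge_ends[OF that] lip that True by simp
    from lipschitz_diam[of \<phi> lo hi, OF this] show ?thesis using A gap True by simp
  next
    case False
    obtain a z where az: "a \<in> A" "z \<in> V - A" "{a, z} \<in> E"
      using connected_boundary_edge[OF conn A(1) _ False] A(2) by auto
    have "card A < card V" using A(1) False finite_V by (simp add: psubset_card_mono psubsetI)
    moreover have "card (insert z A) = card A + 1"
      using az A(1) finite_V by (simp add: finite_subset)
    ultimately have dec: "card V - card (insert z A) < card V - card A" by simp
    from az inner consider "a = lo" | "a = hi" by blast
    then show ?thesis
    proof cases
      case 1
      then show ?thesis using less.hyps[OF dec tails_extend[OF less.prems bad]] az by simp
    next
      case 2
      then show ?thesis using less.hyps[OF dec tails_extend[OF tails_swap[OF less.prems] bad]] az by simp
    qed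
  qed
qed

text \<open>Start of the growth: a tail consisting of \<open>x\<close> at \<open>a\<close>, and an
  empty one at the opposite vertex \<open>d\<close>.\<close>

lemma tails_hexagon:
  assumes h: "circuit V E [a, b, c, d, e, f]" and bad: "\<not> good V E"
    and x: "x \<in> V - {a, b, c, d, e, f}" "{a, x} \<in> E"
  shows "\<exists>\<phi>. tails (insert x {a, b, c, d, e, f}) x d \<phi>"
proof -
  let ?C = "{a, b, c, d, e, f}"
  let ?A = "insert x ?C"
  \<comment> \<open>The distance from \<open>a\<close> along the hexagon, continued by
    \<open>-1\<close> on the tail; the gap \<open>4\<close> between \<open>x\<close> and
    \<open>d\<close> is \<open>7 - 3\<close>.\<close>
  define \<phi> :: "'a \<Rightarrow> int" where
    "\<phi> y = (if y = x then - 1 else if y = a then 0 else if y = b \<or> y = f then 1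
            else if y = c \<or> y = e then 2 else 3)" for y
  note h' = h[unfolded circuit_hexagon]
  have dist: "distinct [x, a, b, c, d, e, f]" using h' x by auto
  have card: "card ?A = 7"
  proof -
    have "card (set [x, a, b, c, d, e, f]) = 7" using dist by (subst distinct_card) auto
    then show ?thesis by simp
  qed
  have vals: "\<phi> x = - 1" "\<phi> a = 0" "\<phi> b = 1" "\<phi> f = 1" "\<phi> c = 2" "\<phi> e = 2" "\<phi> d = 3"
    using dist by (auto simp: \<phi>_def)
  have no_chord: "{a, c} \<notin> E" "{a, d} \<notin> E" "{a, e} \<notin> E" "{b, d} \<notin> E" "{d, f} \<notin> E"
    using hexagon_pendant_chord_good[OF h _ x(2)] bad x(1) by auto
  have no_ear: "{x, y} \<notin> E" if "y \<in> {b, c, d, e, f}" for y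
    using hexagon_ear_good[OF h _ x(2) _ that] bad x(1) by auto
  have lip: "\<bar>\<phi> u - \<phi> v\<bar> \<le> 1" if uv: "u \<in> ?A" "v \<in> ?A" "{u, v} \<in> E" for u v
  proof -
    \<comment> \<open>Both orders are supplied because \<open>no_chord\<close> and
      \<open>no_ear\<close> name each edge in one order.\<close>
    have "{u, v} \<in> E" "{v, u} \<in> E" using uv(3) by (simp_all add: insert_commute)
    with uv(1,2) show ?thesis
      using no_chord no_ear vals by (elim insertE emptyE) simp_all
  qed
  \<comment> \<open>Together with the edge \<open>{a, x}\<close>, such an edge would branch at
    \<open>a\<close> or give pendant edges at two vertices that are not opposite.\<close>
  have inner: "{u, z} \<notin> E" if uz: "u \<in> ?A - {x, d}" "z \<in> V - ?A" for u z
  proof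
    assume E: "{u, z} \<in> E"
    consider "u = a" | "u \<in> {b, c, e, f}" using uz(1) by auto
    then show False
    proof cases
      case 1
      then show ?thesis
        using branch_point_good[OF branch_point_hexagon[OF h], of x z] h' bad x uz(2) E by auto
    next
      case 2
      then show ?thesis
        using hexagon_pendants_good[OF h _ _ _ x(2) E] bad x(1) uz(2) by auto
    qed
  qed
  have both: "\<not> ({x, z} \<in> E \<and> {d, z} \<in> E)" if z: "z \<in> V - ?A" for z
    using hexagon_long_ear_good[OF h _ _ x(2), of z] bad x(1) z by auto
  have "circuit V E [d, e, f, a, b, c]"
    by (rule hexagon_rotate[OF hexagon_rotate[OF hexagon_rotate[OF h]]])
  then have "branch_point {d, e, f, a, b, c} d" by (rule branch_point_hexagon)
  then have br_d: "branch_point ?A d" by (rule branch_point_mono) auto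
  have br_x: "branch_point ?A x"
    using branch_point_extend[OF branch_point_hexagon[OF h], of x] h' x by auto
  have "path_between ?A E x [x, a, b, c, d] d"
    using dist h' x(2) by (auto simp: path_between_def is_path_def insert_commute)
  then have path: "\<exists>p. path_between ?A E x p d \<and> length p + 2 = card ?A"
    using card by (intro exI[of _ "[x, a, b, c, d]"]) simp
  have "?A \<subseteq> V" using h' x by auto
  then have "tails ?A x d \<phi>"
    unfolding tails_def using card lip vals inner both br_d br_x path by (intro conjI ballI) auto
  then show ?thesis by blast
qed

section \<open>Graphs spanned by a hexagon\<close>

lemma hexagon_opposite_diam:
  assumes h: "circuit V E [a, b, c, d, e, f]" and V: "V = {a, b, c, d, e, f}"
    and no_chord: "{a, c} \<notin> E" "{a, d} \<notin> E" "{a, e} \<notin> E" "{b, d} \<notin> E" "{d, f} \<notin> E"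
  shows "3 \<le> diam V E"
proof -
  define \<phi> :: "'a \<Rightarrow> int" where
    "\<phi> y = (if y = a then 0 else if y = b \<or> y = f then 1 else if y = c \<or> y = e then 2 else 3)" for y
  have dist: "distinct [a, b, c, d, e, f]" using h by (simp add: circuit_hexagon)
  have vals: "\<phi> a = 0" "\<phi> b = 1" "\<phi> f = 1" "\<phi> c = 2" "\<phi> e = 2" "\<phi> d = 3"
    using dist by (auto simp: \<phi>_def)
  have "\<bar>\<phi> u - \<phi> v\<bar> \<le> 1" if uv: "{u, v} \<in> E" for u v
  proof -
    have "u \<in> V" "v \<in> V" using edge_ends[OF uv] by auto
    moreover have "{u, v} \<in> E" "{v, u} \<in> E" using uv by (simp_all add: insert_commute)
    ultimately show ?thesis
      unfolding V using no_chord vals by (elim insertE emptyE) simp_all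
  qed
  from lipschitz_diam[of \<phi> a d, OF this] show ?thesis using V vals by simp
qed

text \<open>With diameter at most \<open>2\<close>, each of the three opposite pairs has a chord
  bringing it closer together. A chord spanning two edges helps two of these pairs, and the chord
  needed by the third makes the graph good. Without such chords all three opposite pairs are
  adjacent.\<close>

lemma hexagon_spanning:
  assumes h: "circuit V E [a, b, c, d, e, f]" and V: "V = {a, b, c, d, e, f}"
    and bad: "\<not> good V E"
  shows "3 \<le> diam V E"
proof (rule ccontr)
  assume small: "\<not> 3 \<le> diam V E"
  have h2: "circuit V E [b, c, d, e, f, a]" using h by (rule hexagon_rotate)
  have h3: "circuit V E [c, d, e, f, a, b]" using h2 by (rule hexagon_rotate)
  have h4: "circuit V E [d, e, f, a, b, c]" using h3 by (rule hexagon_rotate)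
  have h5: "circuit V E [e, f, a, b, c, d]" using h4 by (rule hexagon_rotate)
  have h6: "circuit V E [f, a, b, c, d, e]" using h5 by (rule hexagon_rotate)
  have ad: "{a, c} \<in> E \<or> {a, d} \<in> E \<or> {a, e} \<in> E \<or> {b, d} \<in> E \<or> {d, f} \<in> E"
    using hexagon_opposite_diam[OF h V] small by blast
  have "V = {b, c, d, e, f, a}" using V by auto
  then have be: "{b, d} \<in> E \<or> {b, e} \<in> E \<or> {b, f} \<in> E \<or> {c, e} \<in> E \<or> {e, a} \<in> E"
    using hexagon_opposite_diam[OF h2] small by blast
  have "V = {c, d, e, f, a, b}" using V by auto
  then have cf: "{c, e} \<in> E \<or> {c, f} \<in> E \<or> {c, a} \<in> E \<or> {d, f} \<in> E \<or> {f, b} \<in> E"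
    using hexagon_opposite_diam[OF h3] small by blast
  note comm = insert_commute[of _ _ "{}"]
  \<comment> \<open>Each of the six short chords is combined with the condition for the one opposite
    pair that it does not help.\<close>
  have "{a, c} \<notin> E" using hexagon_two_chords_good[OF h] be bad by (auto simp: comm)
  moreover have "{b, d} \<notin> E" using hexagon_two_chords_good[OF h2] cf bad by (auto simp: comm)
  moreover have "{c, e} \<notin> E" using hexagon_two_chords_good[OF h3] ad bad by (auto simp: comm)
  moreover have "{d, f} \<notin> E" using hexagon_two_chords_good[OF h4] be bad by (auto simp: comm)
  moreover have "{e, a} \<notin> E" using hexagon_two_chords_good[OF h5] cf bad by (auto simp: comm)
  moreover have "{f, b} \<notin> E" using hexagon_two_chords_good[OF h6] ad bad by (auto simp: comm)
  ultimately have "{a, d} \<in> E" "{b, e} \<in> E" "{c, f} \<in> E"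
    using ad be cf by (auto simp: comm)
  then show False using hexagon_long_chords_good[OF h] bad by blast
qed

section \<open>The diameter of graphs with a hexagon that are not good\<close>

lemma hexagon_colorable:
  assumes h: "circuit V E [a, b, c, d, e, f]"
  shows "colorable V E (2 * card V - 7)" "6 \<le> card V"
proof -
  note h' = h[unfolded circuit_hexagon]
  have "card (set [a, b, c, d, e, f]) = 6" using h' by (subst distinct_card) auto
  then show card: "6 \<le> card V" using card_mono[OF finite_V, of "set [a, b, c, d, e, f]"] h' by simp
  have "colorable V E (5 + 2 * (card V - length [a, b, c, d, e, f]))"
    using h' by (intro colorable_certificate[OF simple conn _ _ _ _ _ certificate_C6])
      (auto simp: list_edges_def insert_commute)
  moreover have "5 + 2 * (card V - length [a, b, c, d, e, f]) = 2 * card V - 7" using card by simp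
  ultimately show "colorable V E (2 * card V - 7)" by metis
qed

lemma hexagon_diam:
  assumes h: "circuit V E [a, b, c, d, e, f]" and bad: "\<not> good V E"
  shows "int (diam V E) = int (card V) - 3"
proof -
  let ?C = "{a, b, c, d, e, f}"
  note h' = h[unfolded circuit_hexagon]
  \<comment> \<open>The upper bound on the diameter is read off from the coloring with
    \<open>2 * card V - 7\<close> colors.\<close>
  have "2 * diam V E \<le> trc V E + 1"
    using diam_le_trc[OF simple _ hexagon_colorable(1)[OF h]] h' by auto
  moreover have "trc V E \<le> 2 * card V - 7" by (rule trc_le[OF hexagon_colorable(1)[OF h]])
  ultimately have le: "int (diam V E) \<le> int (card V) - 3" using hexagon_colorable(2)[OF h] by linarith
  have "int (card V) - 3 \<le> int (diam V E)"
  proof (cases "?C = V")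
    case True
    then have "card V \<le> 6" using card_length[of "[a, b, c, d, e, f]"] by simp
    then show ?thesis using hexagon_spanning[OF h True[symmetric] bad] by simp
  next
    case False
    have "?C \<subseteq> V" "?C \<noteq> {}" using h' by auto
    from connected_boundary_edge[OF conn this False]
    obtain y x where yx: "y \<in> ?C" "x \<in> V - ?C" "{y, x} \<in> E" .
    have "distinct [a, b, c, d, e, f]" "y \<in> set [a, b, c, d, e, f]" using h' yx(1) by simp_all
    then obtain q where q: "circuit_edges (y # q) = circuit_edges [a, b, c, d, e, f]"
        "set (y # q) = set [a, b, c, d, e, f]" "distinct (y # q)"
        "Suc (length q) = length [a, b, c, d, e, f]"
      by (rule circuit_rotate_to)
    have y_circuit: "circuit V E (y # q)" using q h unfolding circuit_iff by simp
    have "length (y # q) = 6" using q(4) by simp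
    then obtain a' b' c' d' e' f' where eq: "y # q = [a', b', c', d', e', f']" by (rule length6E)
    have C: "{a', b', c', d', e', f'} = ?C" using q(2) unfolding eq by simp
    have "\<exists>\<phi>. tails (insert x {a', b', c', d', e', f'}) x d' \<phi>"
    proof (rule tails_hexagon[OF y_circuit[unfolded eq] bad])
      show "x \<in> V - {a', b', c', d', e', f'}" using yx(2) unfolding C .
      show "{a', x} \<in> E" using yx(3) eq by simp
    qed
    then show ?thesis using tails_diam bad by blast
  qed
  then show ?thesis using le by simp
qed

end

lemma circumference_circuit:
  assumes "cycles V E \<noteq> {}" "finite (cycles V E)"
  obtains p where "circuit V E p" "length p = circumference V E"
proof -
  have "circumference V E \<in> card ` cycles V E"
    unfolding circumference_def using assms by (intro Max_in) auto
  then obtain p where p: "circuit V E p" "circumference V E = card (circuit_edges p)"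
    unfolding cycles_eq by blast
  then have "card (circuit_edges p) = length p"
    unfolding circuit_iff by (simp add: card_circuit_edges)
  then show ?thesis using that[OF p(1)] p(2) by simp
qed

theorem theorem3p5:
  fixes V :: "'a set" and E :: "'a set set" and n :: nat
  assumes "simple_graph V E"
    and "connected_graph V E"
    and "card V = n"
    and "card (cycles V E) \<ge> 2"
    and "circumference V E \<ge> 6"
  shows "if circumference V E = 6 \<and> int (diam V E) = int n - 3
         then int (trc V E) = 2 * int n - 7
         else int (trc V E) \<le> 2 * int n - 9"
proof -
  interpret connected_simple_graph V E by unfold_locales (fact assms)+
  have "cycles V E \<noteq> {}" "finite (cycles V E)"
    \<comment> \<open>Infinite sets have cardinality \<open>0\<close>, so the lower bound on the
      number of cycles also yields finiteness.\<close>
    using assms(4) by (auto intro: card_ge_0_finite)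
  then obtain p where p: "circuit V E p" "length p = circumference V E"
    by (rule circumference_circuit)
  have len: "length p \<le> n"
    using p(1) finite_V assms(3) by (metis card_mono circuit_iff distinct_card)
  have good: "int (trc V E) \<le> 2 * int n - 9" if "good V E"
    using trc_le[OF that[unfolded good_def]] assms(3,5) len p(2) by linarith
  show ?thesis
  proof (cases "circumference V E = 6")
    case False
    then have "7 \<le> length p" using p(2) assms(5) by simp
    have "good V E"
    proof (cases "8 \<le> n")
      case True
      then show ?thesis using long_circuit_good[OF p(1) \<open>7 \<le> length p\<close>] assms(3) by simp
    next
      case False
      \<comment> \<open>Here \<open>7 \<le> length p \<le> n < 8\<close>, so the circuit is a
        spanning heptagon.\<close>
      then show ?thesis
        using heptagon_good[OF p(1)] \<open>7 \<le> length p\<close> len assms(3,4) by simp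
    qed
    then show ?thesis using good False by simp
  next
    case True
    then have "length p = 6" using p(2) by simp
    then obtain a b c d e f where "p = [a, b, c, d, e, f]" by (rule length6E)
    then have h: "circuit V E [a, b, c, d, e, f]" using p(1) by simp
    have n: "6 \<le> n" and ub: "trc V E \<le> 2 * n - 7"
      using hexagon_colorable[OF h] trc_le assms(3) by auto
    have "2 * diam V E \<le> trc V E + 1"
    proof (rule diam_le_trc[OF simple _ hexagon_colorable(1)[OF h]])
      show "V \<noteq> {}" using h by (auto simp: circuit_hexagon)
    qed
    then have "int (trc V E) = 2 * int n - 7" if "int (diam V E) = int n - 3"
      using that ub n by linarith
    \<comment> \<open>A graph that is not good has diameter \<open>n - 3\<close>, so any other
      diameter implies the bound \<open>2 * n - 9\<close>.\<close>
    then show ?thesis using True good hexagon_diam[OF h] assms(3) by auto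
  qed
qed

end
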